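(* For every integer $k>0$, the series $$(q^2,q^3,q^5;q^5)_\infty\sum_{n\ge k}\frac{q^{\binom{k}{2}+(k+1)n}}{(q;q)_n}\left[{n-1\atop k-1}\right]_q$$ has non-negative coefficients (as a formal power series in $q$). For every integer $k>1$, the series $$(q,q^4,q^5;q^5)_\infty\sum_{n\ge k}\frac{q^{\binom{k}{2}+(k+1)n}}{(q;q)_n}\left[{n-1\atop k-1}\right]_q$$ has non-negative coefficients. For $k=1$, the coefficients of $q^7$ and $q^{13}$ in this second series are equal to $-1$, while every other coefficient is non-negative.
   Context: Notation: $(a;q)_\infty=\prod_{j\ge 0}(1-aq^j)$, $(a;q)_n=\prod_{0\le j<n}(1-aq^j)$ for integers $n\ge 0$, $(a_1,\ldots,a_m;q)_\infty=\prod_{1\le j\le m}(a_j;q)_\infty$, and the $q$-binomial coefficient is $\left[{n\atop k}\right]_q=\frac{(q;q)_n}{(q;q)_k(q;q)_{n-k}}$ for integers $0\le k\le n$. *)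

theory Defs
  imports "HOL-Analysis.Analysis"
begin

text \<open>
  The infinite product and the infinite sum below are limits in the coefficientwise topology on
  \<^typ>\<open>rat fps\<close>, and \<^term>\<open>fps_X\<close> plays the role of \<open>q\<close>. The coefficients are integers; rationals are
  used because division of formal power series needs a field.
\<close>

definition qpoch :: "'a \<Rightarrow> 'a \<Rightarrow> nat \<Rightarrow> 'a :: comm_ring_1"
  where "qpoch a q n = (\<Prod>j<n. 1 - a * q ^ j)"

definition qpoch_inf :: "'a \<Rightarrow> 'a \<Rightarrow> 'a :: {t2_space, comm_ring_1}"
  where "qpoch_inf a q = (\<Prod>j. 1 - a * q ^ j)"

definition qpochs_inf :: "'a list \<Rightarrow> 'a \<Rightarrow> 'a :: {t2_space, comm_ring_1}"
  where "qpochs_inf as q = (\<Prod>a\<leftarrow>as. qpoch_inf a q)"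

text \<open>
  Only meant for \<open>k \<le> n\<close>. For power series with \<open>q\<close> lacking a constant term, the denominator is a
  unit, so the division is the exact one.
\<close>
definition qbinom :: "'a \<Rightarrow> nat \<Rightarrow> nat \<Rightarrow> 'a :: {comm_ring_1, inverse}"
  where "qbinom q n k = qpoch q q n / (qpoch q q k * qpoch q q (n - k))"

definition qterm :: "nat \<Rightarrow> nat \<Rightarrow> rat fps"
  where "qterm k n =
    fps_X ^ ((k choose 2) + (k + 1) * n) / qpoch fps_X fps_X n * qbinom fps_X (n - 1) (k - 1)"

definition qseries :: "nat \<Rightarrow> rat fps"
  where "qseries k = (\<Sum>\<^sub>\<infinity>n\<in>{k..}. qterm k n)"


text \<open>
  The product and the sum converge, so neither \<^const>\<open>qpoch_inf\<close> (as used here) nor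
  \<^const>\<open>qseries\<close> is a default value.
\<close>

lemma fps_mult_power_nth_eq_0:
  fixes f q :: "'a :: comm_ring_1 fps"
  assumes "fps_nth q 0 = 0" "k < m"
  shows   "fps_nth (f * q ^ m) k = 0"
  unfolding fps_mult_nth
  using startsby_zero_power_prefix[OF assms(1), of m] assms(2)
  by (intro sum.neutral) auto

lemma has_prod_qpoch_inf:
  fixes a q :: "'a :: idom fps"
  assumes a: "fps_nth a 0 = 0" and q: "fps_nth q 0 = 0"
  shows   "(\<lambda>j. 1 - a * q ^ j) has_prod qpoch_inf a q"
proof -
  define P where "P = (\<lambda>n. \<Prod>j\<le>n. 1 - a * q ^ j)"
  define p where "p = Abs_fps (\<lambda>k. fps_nth (P k) k)"
  have stable: "fps_nth (P n) k = fps_nth (P k) k" if "n \<ge> k" for n k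
    using that
  proof (induction n rule: dec_induct)
    case (step n)
    have "P (Suc n) = P n * (1 - a * q ^ Suc n)"
      unfolding P_def by (rule prod.atMost_Suc)
    hence "P (Suc n) = P n - (P n * a) * q ^ Suc n"
      by (simp only: right_diff_distrib mult_1_right mult.assoc)
    moreover have "fps_nth ((P n * a) * q ^ Suc n) k = 0"
      by (rule fps_mult_power_nth_eq_0) (use q step in auto)
    ultimately show ?case
      using step.IH by simp
  qed auto
  have "P \<longlonglongrightarrow> p"
  proof (rule tendsto_fpsI)
    fix k
    show "eventually (\<lambda>n. fps_nth (P n) k = fps_nth p k) sequentially"
      using eventually_ge_at_top[of k]
      unfolding p_def fps_nth_Abs_fps by eventually_elim (rule stable)
  qed
  moreover have "fps_nth p 0 = 1"
    by (simp add: p_def P_def a)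
  hence "p \<noteq> 0"
    by auto
  ultimately have "(\<lambda>j. 1 - a * q ^ j) has_prod p"
    by (simp add: has_prod_def raw_has_prod_def P_def)
  moreover from this have "p = qpoch_inf a q"
    unfolding qpoch_inf_def by (rule has_prod_unique)
  ultimately show ?thesis
    by simp
qed

lemma has_sum_qseries: "(qterm k has_sum qseries k) {k..}"
proof -
  have zero: "fps_nth (qterm k n) m = 0" if "m < n" for m n
  proof -
    define u where "u = qpoch (fps_X :: rat fps) fps_X n"
    define e where "e = (k choose 2) + (k + 1) * n"
    have "fps_nth u 0 \<noteq> 0"
      unfolding u_def qpoch_def by (induction n) simp_all
    hence "fps_X ^ e / u = fps_X ^ e * inverse u"
      by (rule fps_divide_unit)
    hence "qterm k n = (inverse u * qbinom fps_X (n - 1) (k - 1)) * fps_X ^ e"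
      unfolding qterm_def u_def[symmetric] e_def[symmetric]
      by (simp only: mult_ac)
    moreover have "m < e"
      using that by (simp add: e_def)
    ultimately show ?thesis
      using fps_mult_power_nth_eq_0[of fps_X m e] by simp
  qed
  define A where "A = (\<lambda>m. {n\<in>{k..}. fps_nth (qterm k n) m \<noteq> 0})"
  have "A m \<subseteq> {..m}" for m
  proof
    fix n assume "n \<in> A m"
    hence "\<not> m < n"
      using zero[of m n] unfolding A_def by blast
    thus "n \<in> {..m}"
      by simp
  qed
  hence "finite (A m)" for m
    by (rule finite_subset) auto
  hence "(qterm k has_sum Abs_fps (\<lambda>m. \<Sum>n\<in>A m. fps_nth (qterm k n) m)) {k..}"
    unfolding A_def by (intro has_sum_fpsI) simp_all
  hence "qterm k summable_on {k..}"
    unfolding summable_on_def by blast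
  thus ?thesis
    unfolding qseries_def by (rule has_sum_infsum)
qed

end

(*
  Write s(k) = k(3k+1)/2 and S(k) for the sum in the theorem. Combining S(k) and S(k+1) term by term
  and applying Euler's identity sum_m z^m/(q;q)_m = 1/(z;q)_inf gives
    (q;q)_inf (S(k) + S(k+1)) = q^s(k) (1 - q^(2k+1)),
  so (q;q)_inf S(k) is the alternating sum of q^s(j) (1 - q^(2j+1)) over j >= k. The two series are this sum
  divided by (q,q^4;q^5)_inf and by (q^2,q^3;q^5)_inf, respectively.

  Dividing by three factors only, with exponents 1, 4, 9 or 2, 3, 7, the coefficient of q^n is an alternating
  sum of values of a quadratic quasi-polynomial. Its polynomial part telescopes to something of order at
  least n; the periodic part contributes a bounded amount, because the signed sum over a full period
  vanishes. This proves non-negativity for n >= 495, and the remaining n are checked by computation.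
  The only negative coefficients occur for k = 1, at 9 and 35 and at 7, 13 and 127, respectively. Dividing by one more
  factor 1 - q^6 removes the first two; dividing by 1 - q^8 removes 127, while -q^7 and -q^13 survive and
  are too small to spoil any other coefficient of the quotient by the remaining factors.
*)
theory Submission
  imports Defs
begin

section \<open>The recurrence in k\<close>

definition fps_eq_upto :: "nat \<Rightarrow> 'a::comm_ring_1 fps \<Rightarrow> 'a fps \<Rightarrow> bool"
  where "fps_eq_upto n f g \<longleftrightarrow> (\<forall>i\<le>n. fps_nth f i = fps_nth g i)"

lemma fps_eq_upto_mult:
  assumes "fps_eq_upto n f f'" "fps_eq_upto n g g'"
  shows   "fps_eq_upto n (f * g) (f' * g')"
  using assms by (auto simp: fps_eq_upto_def fps_mult_nth intro!: sum.cong)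

lemma fps_eq_upto_refl [simp]: "fps_eq_upto n f f"
  by (simp add: fps_eq_upto_def)

lemma fps_eq_upto_imp_eq: "(\<And>n. fps_eq_upto n f g) \<Longrightarrow> f = g"
  by (auto simp: fps_eq_upto_def fps_eq_iff)

text \<open>The factor \<open>1 - a * q ^ n\<close> changes a partial product only by a multiple of
  \<open>q ^ n\<close>, so coefficient \<open>m\<close> is final once the factors with index up to
  \<open>m\<close> are present.\<close>

lemma qpoch_nth_stable:
  fixes a q :: "'a :: comm_ring_1 fps"
  assumes q: "fps_nth q 0 = 0" and "m < M" "M \<le> M'"
  shows   "fps_nth (qpoch a q M') m = fps_nth (qpoch a q M) m"
  using assms(3)
proof (induction M' rule: dec_induct)
  case (step n)
  have "qpoch a q (Suc n) = qpoch a q n - (qpoch a q n * a) * q ^ n"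
    by (simp add: qpoch_def algebra_simps)
  moreover have "fps_nth ((qpoch a q n * a) * q ^ n) m = 0"
    by (rule fps_mult_power_nth_eq_0) (use q step assms in auto)
  ultimately show ?case
    using step.IH by simp
qed auto

lemma qpoch_inf_nth:
  fixes a q :: "'a :: idom fps"
  assumes "fps_nth a 0 = 0" and q: "fps_nth q 0 = 0" and "m < M"
  shows   "fps_nth (qpoch_inf a q) m = fps_nth (qpoch a q M) m"
proof -
  have "(\<lambda>n. \<Prod>j\<le>n. 1 - a * q ^ j) \<longlonglongrightarrow> qpoch_inf a q"
    by (intro has_prod_imp_tendsto has_prod_qpoch_inf assms)
  hence "eventually (\<lambda>n. fps_nth (\<Prod>j\<le>n. 1 - a * q ^ j) m = fps_nth (qpoch_inf a q) m) sequentially"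
    unfolding tendsto_fps_iff by blast
  hence "eventually (\<lambda>n. fps_nth (\<Prod>j\<le>n. 1 - a * q ^ j) m = fps_nth (qpoch_inf a q) m \<and> n \<ge> M) sequentially"
    by (intro eventually_conj eventually_ge_at_top)
  then obtain n where n: "fps_nth (\<Prod>j\<le>n. 1 - a * q ^ j) m = fps_nth (qpoch_inf a q) m" "n \<ge> M"
    by (auto simp: eventually_sequentially)
  have "(\<Prod>j\<le>n. 1 - a * q ^ j) = qpoch a q (Suc n)"
    by (simp add: qpoch_def lessThan_Suc_atMost)
  with n qpoch_nth_stable[OF q assms(3), of "Suc n" a] show ?thesis
    by simp
qed

lemma qpoch_inf_eq_upto:
  fixes a q :: "'a :: idom fps"
  assumes "fps_nth a 0 = 0" "fps_nth q 0 = 0" "n < M"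
  shows   "fps_eq_upto n (qpoch_inf a q) (qpoch a q M)"
  using assms by (auto simp: fps_eq_upto_def intro!: qpoch_inf_nth)

section \<open>Splitting the Euler product by residues modulo 5\<close>

lemma qpoch_X_split:
  "qpoch (fps_X :: 'a::comm_ring_1 fps) fps_X (5 * m) =
     qpoch fps_X (fps_X^5) m * qpoch (fps_X^2) (fps_X^5) m * qpoch (fps_X^3) (fps_X^5) m *
     qpoch (fps_X^4) (fps_X^5) m * qpoch (fps_X^5) (fps_X^5) m"
proof (induction m)
  case (Suc m)
  define z where "z = (fps_X :: 'a fps) ^ (5 * m)"
  have z: "(fps_X ^ 5) ^ m = z"
    by (simp add: z_def power_mult)
  \<comment> \<open>Unfolds exactly five new factors, with exponents 5m + 1 to 5m + 5, one for each
    residue class.\<close>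
  have *: "5 * Suc m = Suc (Suc (Suc (Suc (Suc (5 * m)))))"
    by simp
  define p where "p = qpoch (fps_X :: 'a fps) fps_X (5 * m)"
  have "qpoch (fps_X :: 'a fps) fps_X (5 * Suc m) = p *
     (1 - fps_X * z) * (1 - fps_X^2 * z) * (1 - fps_X^3 * z) * (1 - fps_X^4 * z) * (1 - fps_X^5 * z)"
    unfolding * qpoch_def prod.lessThan_Suc power_Suc z_def[symmetric] p_def[unfolded qpoch_def, symmetric]
    by (simp add: eval_nat_numeral mult.assoc)
  thus ?case unfolding p_def Suc.IH
    by (simp only: qpoch_def prod.lessThan_Suc z mult_ac)
qed (simp add: qpoch_def)

abbreviation (input) "X \<equiv> fps_X :: rat fps"

definition euler :: "rat fps" where "euler = qpoch_inf X X"

text \<open>Lets the prefactor of the first series be read as \<open>euler\<close> divided by the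
  product over the classes 1 and 4 modulo 5.\<close>

lemma euler_split:
  "euler = qpochs_inf [X^2, X^3, X^5] (X^5) * qpochs_inf [X, X^4] (X^5)"
proof (rule fps_eq_upto_imp_eq)
  fix n
  define m where "m = Suc n"
  have 1: "fps_eq_upto n (qpoch_inf (X^r) (X^5)) (qpoch (X^r) (X^5) m)" if "r > 0" for r
    by (rule qpoch_inf_eq_upto) (use that in \<open>auto simp: m_def\<close>)
  have "fps_eq_upto n (qpochs_inf [X^2, X^3, X^5] (X^5) * qpochs_inf [X, X^4] (X^5))
      ((qpoch (X^2) (X^5) m * (qpoch (X^3) (X^5) m * (qpoch (X^5) (X^5) m * 1))) *
       (qpoch (X^1) (X^5) m * (qpoch (X^4) (X^5) m * 1)))"
    unfolding qpochs_inf_def list.map prod_list.Cons prod_list.Nil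
    using 1[of 1] by (intro fps_eq_upto_mult 1) auto
  also have "((qpoch (X^2) (X^5) m * (qpoch (X^3) (X^5) m * (qpoch (X^5) (X^5) m * 1))) *
       (qpoch (X^1) (X^5) m * (qpoch (X^4) (X^5) m * 1))) = qpoch X X (5 * m)"
    unfolding qpoch_X_split by (simp add: mult_ac)
  finally have 2: "fps_eq_upto n (qpochs_inf [X^2, X^3, X^5] (X^5) * qpochs_inf [X, X^4] (X^5))
     (qpoch X X (5 * m))" .
  have "fps_eq_upto n euler (qpoch X X (5 * m))" unfolding euler_def
    by (rule qpoch_inf_eq_upto) (auto simp: m_def)
  with 2 show "fps_eq_upto n euler (qpochs_inf [X^2, X^3, X^5] (X^5) * qpochs_inf [X, X^4] (X^5))"
    by (auto simp: fps_eq_upto_def)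
qed

lemma euler_split':
  "euler = qpochs_inf [X, X^4, X^5] (X^5) * qpochs_inf [X^2, X^3] (X^5)"
  unfolding euler_split by (simp add: qpochs_inf_def mult_ac)


text \<open>Agrees with the infinite sum when \<open>f n\<close> has no coefficient below degree
  \<open>n\<close>, since then terms with \<open>n > m\<close> do not reach coefficient
  \<open>m\<close>.\<close>

definition fsum :: "(nat \<Rightarrow> 'a::comm_ring_1 fps) \<Rightarrow> 'a fps"
  where "fsum f = Abs_fps (\<lambda>m. \<Sum>n\<le>m. fps_nth (f n) m)"

lemma fsum_add: "fsum (\<lambda>n. f n + g n) = fsum f + fsum g"
  by (simp add: fsum_def fps_eq_iff sum.distrib)

lemma fsum_diff: "fsum (\<lambda>n. f n - g n) = fsum f - fsum g"
  by (simp add: fsum_def fps_eq_iff sum_subtractf)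

lemma fsum_nth_extend:
  assumes "\<And>n m. m < n \<Longrightarrow> fps_nth (f n) m = 0" and "m \<le> M"
  shows   "fps_nth (fsum f) m = (\<Sum>n\<le>M. fps_nth (f n) m)"
  unfolding fsum_def fps_nth_Abs_fps
  by (rule sum.mono_neutral_left) (use assms in auto)

lemma fsum_mult_left:
  assumes "\<And>n m. m < n \<Longrightarrow> fps_nth (f n) m = 0"
  shows   "fsum (\<lambda>n. c * f n) = c * fsum f"
proof (rule fps_ext)
  fix m
  have "fps_nth (c * fsum f) m = (\<Sum>i=0..m. fps_nth c i * (\<Sum>n\<le>m. fps_nth (f n) (m - i)))"
    unfolding fps_mult_nth
    by (intro sum.cong refl, subst fsum_nth_extend[where M = m]) (use assms in auto)
  also have "\<dots> = (\<Sum>n\<le>m. fps_nth (c * f n) m)"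
    unfolding fps_mult_nth sum_distrib_left by (rule sum.swap)
  finally show "fps_nth (fsum (\<lambda>n. c * f n)) m = fps_nth (c * fsum f) m"
    by (simp add: fsum_def)
qed

lemma fsum_shift:
  fixes g :: "nat \<Rightarrow> rat fps"
  assumes "\<And>n m. m < n \<Longrightarrow> fps_nth (g n) m = 0"
  shows   "fsum (\<lambda>n. if n < k then 0 else X ^ k * g (n - k)) = X ^ k * fsum g"
proof (rule fps_ext)
  fix m
  have "fps_nth (fsum (\<lambda>n. if n < k then 0 else X ^ k * g (n - k))) m =
     (\<Sum>n\<le>m. if n < k then 0 else fps_nth (X ^ k * g (n - k)) m)"
    unfolding fsum_def fps_nth_Abs_fps by (intro sum.cong) auto
  also have "\<dots> = (\<Sum>n\<in>{k..m}. fps_nth (X ^ k * g (n - k)) m)"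
    by (rule sum.mono_neutral_cong_right) auto
  also have "\<dots> = (\<Sum>n\<in>{k..m}. fps_nth (g (n - k)) (m - k))"
    by (rule sum.cong) (auto simp: fps_X_power_mult_nth)
  also have "\<dots> = (if m < k then 0 else \<Sum>n\<le>m - k. fps_nth (g n) (m - k))"
  proof (cases "m < k")
    case False
    have "(\<Sum>n\<in>{k..m}. fps_nth (g (n - k)) (m - k)) = (\<Sum>n\<le>m - k. fps_nth (g n) (m - k))"
      by (rule sum.reindex_bij_witness[of _ "\<lambda>n. n + k" "\<lambda>n. n - k"]) (use False in auto)
    with False show ?thesis by simp
  qed auto
  also have "\<dots> = fps_nth (X ^ k * fsum g) m"
    by (simp add: fps_X_power_mult_nth fsum_def)
  finally show "fps_nth (fsum (\<lambda>n. if n < k then 0 else X ^ k * g (n - k))) m = fps_nth (X ^ k * fsum g) m" .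
qed

text \<open>In the coefficientwise topology, coefficient \<open>m\<close> of the partial sums is
  constant from some finite index set on; that set is enlarged by all indices up to
  \<open>m\<close>, and its other members contribute zero.\<close>

lemma has_sum_fps_nth:
  fixes f :: "nat \<Rightarrow> 'a::comm_ring_1 fps"
  assumes "(f has_sum S) A" and z: "\<And>n. n \<in> A \<Longrightarrow> m < n \<Longrightarrow> fps_nth (f n) m = 0"
  shows   "fps_nth S m = (\<Sum>n\<in>A \<inter> {..m}. fps_nth (f n) m)"
proof -
  have "(sum f \<longlongrightarrow> S) (finite_subsets_at_top A)"
    using assms(1) by (simp add: has_sum_def)
  hence "eventually (\<lambda>F. fps_nth (sum f F) m = fps_nth S m) (finite_subsets_at_top A)"
    by (simp add: tendsto_fps_iff)
  then obtain F where F: "finite F" "F \<subseteq> A"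
    "\<And>Y. finite Y \<Longrightarrow> F \<subseteq> Y \<Longrightarrow> Y \<subseteq> A \<Longrightarrow> fps_nth (sum f Y) m = fps_nth S m"
    by (auto simp: eventually_finite_subsets_at_top)
  have "fps_nth S m = fps_nth (sum f (F \<union> (A \<inter> {..m}))) m"
    by (rule F(3)[symmetric]) (use F in auto)
  also have "\<dots> = (\<Sum>n\<in>F \<union> (A \<inter> {..m}). fps_nth (f n) m)"
    by (simp add: fps_sum_nth)
  also have "\<dots> = (\<Sum>n\<in>A \<inter> {..m}. fps_nth (f n) m)"
    by (rule sum.mono_neutral_right) (use F in \<open>auto intro!: z\<close>)
  finally show ?thesis .
qed

abbreviation (input) "qf \<equiv> qpoch X X"

lemma qf_0 [simp]: "fps_nth (qf n) 0 = 1"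
  unfolding qpoch_def by (induction n) simp_all

lemma qf_Suc: "qf (Suc n) = qf n * (1 - X ^ Suc n)"
  by (simp add: qpoch_def)

lemma qf_nonzero [simp]: "qf n \<noteq> 0"
proof
  assume "qf n = 0"
  hence "fps_nth (qf n) 0 = 0" by simp
  thus False by simp
qed

lemma qf_inverse: "qf n * inverse (qf n) = 1"
  by (rule inverse_mult_eq_1') simp

lemma inverse_qf: "inverse (qf n) = (1 - X ^ Suc n) * inverse (qf (Suc n))"
proof -
  have "qf n * inverse (qf n) = qf n * ((1 - X ^ Suc n) * inverse (qf (Suc n)))"
    using qf_inverse[of n] qf_inverse[of "Suc n"] by (simp only: qf_Suc mult_ac)
  thus ?thesis by simp
qed

lemma qterm_eq:
  "qterm k n = X ^ ((k choose 2) + (k + 1) * n) * inverse (qf n) *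
     (qf (n - 1) * (inverse (qf (k - 1)) * inverse (qf (n - 1 - (k - 1)))))"
  unfolding qterm_def qbinom_def
  by (simp add: fps_divide_unit fps_inverse_mult)

lemma qterm_nth_0: assumes "m < n" shows "fps_nth (qterm k n) m = 0"
  unfolding qterm_eq mult.assoc using assms
  by (subst fps_X_power_mult_nth) auto

lemma qseries_eq: "qseries k = fsum (\<lambda>n. if n < k then 0 else qterm k n)"
proof (rule fps_ext)
  fix m
  have "fps_nth (qseries k) m = (\<Sum>n\<in>{k..} \<inter> {..m}. fps_nth (qterm k n) m)"
    by (rule has_sum_fps_nth[OF has_sum_qseries]) (rule qterm_nth_0)
  also have "\<dots> = fps_nth (fsum (\<lambda>n. if n < k then 0 else qterm k n)) m"
    unfolding fsum_def fps_nth_Abs_fps by (rule sum.mono_neutral_cong_left) auto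
  finally show "fps_nth (qseries k) m = fps_nth (fsum (\<lambda>n. if n < k then 0 else qterm k n)) m" .
qed

lemma qseries_nth_0: "m < k \<Longrightarrow> fps_nth (qseries k) m = 0"
  unfolding qseries_eq fsum_def by (auto intro!: sum.neutral)

section \<open>Euler's identity for the sum of z^m/(q;q)_m at z = q^k\<close>

definition euler_sum :: "nat \<Rightarrow> rat fps"
  where "euler_sum k = fsum (\<lambda>m. X ^ (k * m) * inverse (qf m))"

lemma power_mult_nth_0: assumes "k > 0" "m < n" shows "fps_nth (X ^ (k * n) * f) m = 0"
proof -
  have "m < k * n" using assms by (metis less_le_trans mult_le_mono1 nat_mult_1 Suc_leI One_nat_def)
  thus ?thesis by (simp add: fps_X_power_mult_nth)
qed

text \<open>With F(z) = sum_m z^m/(q;q)_m and z = q^k this is F(z) - F(qz) = z F(z), which holds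
  because (1 - q^m)/(q;q)_m = 1/(q;q)_(m-1).\<close>

lemma euler_sum_Suc:
  assumes "k > 0"
  shows   "euler_sum (Suc k) = (1 - X ^ k) * euler_sum k"
proof -
  define g where "g = (\<lambda>m. X ^ (k * m) * inverse (qf m))"
  have z: "fps_nth (g n) m = 0" if "m < n" for n m
    unfolding g_def by (rule power_mult_nth_0[OF assms that])
  have "euler_sum k - euler_sum (Suc k) = fsum (\<lambda>m. g m - X ^ (Suc k * m) * inverse (qf m))"
    by (simp add: euler_sum_def fsum_diff g_def)
  also have "(\<lambda>m. g m - X ^ (Suc k * m) * inverse (qf m)) =
     (\<lambda>m. if m < 1 then 0 else X ^ 1 * (X ^ (k - 1) * g (m - 1)))"
  proof
    fix m show "g m - X ^ (Suc k * m) * inverse (qf m) =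
       (if m < 1 then 0 else X ^ 1 * (X ^ (k - 1) * g (m - 1)))"
    proof (cases m)
      case (Suc l)
      have "g m - X ^ (Suc k * m) * inverse (qf m) = X ^ (k * m) * ((1 - X ^ m) * inverse (qf m))"
        by (simp add: g_def power_add algebra_simps)
      also have "(1 - X ^ m) * inverse (qf m) = inverse (qf l)"
        using inverse_qf[of l] Suc by simp
      also have "X ^ (k * m) = X ^ 1 * X ^ (k - 1) * X ^ (k * l)"
        unfolding power_add[symmetric] using assms Suc by simp
      finally show ?thesis using Suc by (simp add: g_def mult_ac)
    qed (simp add: g_def)
  qed
  also have "fsum (\<lambda>m. if m < 1 then 0 else X ^ 1 * (X ^ (k - 1) * g (m - 1))) =
      X ^ 1 * fsum (\<lambda>m. X ^ (k - 1) * g m)"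
    by (rule fsum_shift) (use z in \<open>auto simp: fps_X_power_mult_nth\<close>)
  also have "fsum (\<lambda>m. X ^ (k - 1) * g m) = X ^ (k - 1) * fsum g"
    by (rule fsum_mult_left) (rule z)
  also have "fsum g = euler_sum k" by (simp add: euler_sum_def g_def)
  also have "X ^ 1 * (X ^ (k - 1) * euler_sum k) = X ^ k * euler_sum k"
    using assms by (simp add: mult.assoc[symmetric] power_Suc[symmetric] del: power_Suc)
  finally show ?thesis by (simp add: algebra_simps)
qed

lemma qf_euler_sum: "qf (k + M) * euler_sum (k + 1) = qf k * euler_sum (k + M + 1)"
proof (induction M)
  case (Suc M)
  have "qf (k + Suc M) * euler_sum (k + 1) = (1 - X ^ (k + M + 1)) * (qf (k + M) * euler_sum (k + 1))"
    using qf_Suc[of "k + M"] by simp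
  also have "\<dots> = qf k * ((1 - X ^ (k + M + 1)) * euler_sum (k + M + 1))"
    unfolding Suc.IH by simp
  also have "(1 - X ^ (k + M + 1)) * euler_sum (k + M + 1) = euler_sum (k + Suc M + 1)"
    using euler_sum_Suc[of "k + M + 1"] by simp
  finally show ?case .
qed auto

lemma euler_sum_nth:
  assumes "m < k"
  shows "fps_nth (euler_sum k) m = (if m = 0 then 1 else 0)"
proof -
  have "fps_nth (euler_sum k) m = (\<Sum>n\<le>m. fps_nth (X ^ (k * n) * inverse (qf n)) m)"
    by (simp add: euler_sum_def fsum_def)
  also have "\<dots> = (\<Sum>n\<le>m. if n = 0 then (if m = 0 then 1 else 0) else 0)"
  proof (rule sum.cong)
    fix n
    have "m < k * n" if "n > 0" using assms that
      by (metis less_le_trans mult_le_mono2 nat_mult_1_right Suc_leI One_nat_def)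
    thus "fps_nth (X ^ (k * n) * inverse (qf n)) m = (if n = 0 then (if m = 0 then 1 else 0) else 0)"
      by (auto simp: fps_X_power_mult_nth qpoch_def)
  qed auto
  finally show ?thesis by simp
qed

text \<open>The limit of \<open>qf_euler_sum\<close> for growing \<open>M\<close>:
  \<open>qf (k + M)\<close> tends to \<open>euler\<close> and \<open>euler_sum (k + M + 1)\<close>
  to 1. Up to degree \<open>n\<close>, \<open>M = Suc n\<close> is large enough.\<close>

lemma euler_euler_sum: "euler * euler_sum (k + 1) = qf k"
proof (rule fps_eq_upto_imp_eq)
  fix n
  have 1: "fps_eq_upto n (euler * euler_sum (k + 1)) (qf (k + Suc n) * euler_sum (k + 1))"
    unfolding euler_def by (intro fps_eq_upto_mult qpoch_inf_eq_upto) auto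
  have "fps_eq_upto n (euler_sum (k + Suc n + 1)) 1"
    by (auto simp: fps_eq_upto_def euler_sum_nth)
  hence 2: "fps_eq_upto n (qf k * euler_sum (k + Suc n + 1)) (qf k * 1)"
    by (intro fps_eq_upto_mult) auto
  show "fps_eq_upto n (euler * euler_sum (k + 1)) (qf k)"
    using 1 2 unfolding qf_euler_sum by (auto simp: fps_eq_upto_def)
qed

section \<open>Combining the series for k and k + 1\<close>

definition pent_nat :: "nat \<Rightarrow> nat" where "pent_nat k = k * (3 * k + 1) div 2"

lemma pent_nat_eq: "(k choose 2) + k * (k + 1) = pent_nat k"
proof -
  have "2 * (k choose 2) = k * (k - 1)" unfolding choose_two by (cases k) auto
  moreover have "even (k * (3 * k + 1))" by auto
  hence "2 * pent_nat k = k * (3 * k + 1)" unfolding pent_nat_def by simp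
  ultimately show ?thesis by (cases k) (auto simp: algebra_simps)
qed

text \<open>Both terms contain \<open>v\<close>, which is 1/(1 - q^n), and (1 - q^k) + q^(k+n) (1 -
  q^(n-k)) = (1 - q^n) (1 - q^k + q^n), so this denominator cancels.\<close>

lemma qterm_add:
  assumes k: "k > 0" and n: "n \<ge> k"
  shows "qf k * (qterm k n + (if n < Suc k then 0 else qterm (Suc k) n)) =
     X ^ ((k choose 2) + (k + 1) * n) * (1 - X ^ k + X ^ n) * inverse (qf (n - k))"
proof -
  define v where "v = inverse (qf n) * qf (n - 1)"
  have v: "v * (1 - X ^ n) = 1"
    using qf_inverse[of n] k n qf_Suc[of "n - 1"] unfolding v_def by (simp add: mult_ac)
  define Y where "Y = X ^ ((k choose 2) + (k + 1) * n)"
  define I where "I = inverse (qf (n - k))"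
  have ik: "inverse (qf (k - 1)) = (1 - X ^ k) * inverse (qf k)"
    using inverse_qf[of "k - 1"] k by simp
  have "qterm k n = Y * v * ((1 - X ^ k) * inverse (qf k)) * I"
    unfolding qterm_eq Y_def v_def I_def ik using k n by (simp add: mult_ac)
  hence 1: "qf k * qterm k n = (qf k * inverse (qf k)) * (Y * v * (1 - X ^ k) * I)"
    by (simp only: mult_ac)
  have 2: "qf k * (if n < Suc k then 0 else qterm (Suc k) n) = Y * v * X ^ (k + n) * (1 - X ^ (n - k)) * I"
  \<comment> \<open>At \<open>n = k\<close> the second term is absent, and the factor 1 - q^0 on the
    right vanishes as well.\<close>
  proof (cases "n = k")
    case False
    hence nk: "n \<ge> Suc k" using n by simp
    have i: "inverse (qf (n - Suc k)) = (1 - X ^ (n - k)) * I"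
      using inverse_qf[of "n - Suc k"] nk Suc_diff_Suc[of k n] by (simp add: I_def)
    have "(Suc k choose 2) + (Suc k + 1) * n = (k choose 2) + (k + 1) * n + (k + n)"
      by (simp add: numeral_2_eq_2 algebra_simps)
    hence Y': "X ^ ((Suc k choose 2) + (Suc k + 1) * n) = Y * X ^ (k + n)"
      by (simp only: Y_def power_add)
    have "qterm (Suc k) n = Y * X ^ (k + n) * v * inverse (qf k) * ((1 - X ^ (n - k)) * I)"
      unfolding qterm_eq Y' v_def i[symmetric] using nk by (simp add: mult_ac)
    hence "qf k * qterm (Suc k) n = (qf k * inverse (qf k)) * (Y * X ^ (k + n) * v * ((1 - X ^ (n - k)) * I))"
      by (simp only: mult_ac)
    thus ?thesis using nk unfolding qf_inverse by (simp add: mult_ac)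
  qed auto
  have e: "X ^ (k + n) * X ^ (n - k) = X ^ n * X ^ n"
    unfolding power_add[symmetric] using n by (intro arg_cong[of _ _ "(^) X"]) simp
  have "qf k * (qterm k n + (if n < Suc k then 0 else qterm (Suc k) n)) =
      Y * v * I * ((1 - X ^ k) + (X ^ (k + n) - X ^ (k + n) * X ^ (n - k)))"
    unfolding distrib_left 1 2 qf_inverse by (simp add: algebra_simps)
  also have "(1 - X ^ k) + (X ^ (k + n) - X ^ (k + n) * X ^ (n - k)) = (1 - X ^ n) * (1 - X ^ k + X ^ n)"
    unfolding e by (simp add: power_add algebra_simps)
  also have "Y * v * I * ((1 - X ^ n) * (1 - X ^ k + X ^ n)) = (v * (1 - X ^ n)) * (Y * (1 - X ^ k + X ^ n) * I)"
    by (simp only: mult_ac)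
  finally show ?thesis unfolding v Y_def I_def by simp
qed

definition pent_pair :: "nat \<Rightarrow> rat fps"
  where "pent_pair k = X ^ pent_nat k * (1 - X ^ (2 * k + 1))"

lemma euler_qseries_add:
  assumes k: "k > 0"
  shows   "euler * qseries k + euler * qseries (Suc k) = pent_pair k"
proof -
  define g where "g = (\<lambda>m. X ^ ((k + 1) * m) * inverse (qf m))"
  define g' where "g' = (\<lambda>m. X ^ ((k + 2) * m) * inverse (qf m))"
  define C where "C = (k choose 2) + k * k"
  have z: "fps_nth (g n) m = 0" "fps_nth (g' n) m = 0" if "m < n" for n m
    unfolding g_def g'_def by (rule power_mult_nth_0; use that in simp)+
  have z1: "fps_nth (c * g n) m = 0" "fps_nth (c * g' n) m = 0" if "m < n" for n m c
    unfolding g_def g'_def by (simp only: mult.left_commute[of c]; rule power_mult_nth_0; use that in simp)+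
  \<comment> \<open>The summand after the shift \<open>n = k + m\<close>, with q^k taken out for
    \<open>fsum_shift\<close>. The factor 1 - q^k + q^n splits it into terms of the Euler sums at
    q^(k+1) and q^(k+2).\<close>
  define h where "h = (\<lambda>m. X ^ C * (1 - X ^ k) * g m + X ^ (C + k) * g' m)"
  have zh: "fps_nth (h n) m = 0" if "m < n" for n m
    unfolding h_def using that by (simp add: z1)
  have zq: "fps_nth (if n < k then 0 else qterm k n + (if n < Suc k then 0 else qterm (Suc k) n)) m = 0" if "m < n" for n m k
    using that by (simp add: qterm_nth_0)
  have "qseries k + qseries (Suc k) =
     fsum (\<lambda>n. if n < k then 0 else qterm k n + (if n < Suc k then 0 else qterm (Suc k) n))"
    unfolding qseries_eq fsum_add[symmetric] by (intro arg_cong[of _ _ fsum]) auto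
  hence "qf k * (qseries k + qseries (Suc k)) =
     fsum (\<lambda>n. qf k * (if n < k then 0 else qterm k n + (if n < Suc k then 0 else qterm (Suc k) n)))"
    using fsum_mult_left[OF zq] by simp
  also have "(\<lambda>n. qf k * (if n < k then 0 else qterm k n + (if n < Suc k then 0 else qterm (Suc k) n))) =
     (\<lambda>n. if n < k then 0 else X ^ k * h (n - k))"
  proof
    fix n show "qf k * (if n < k then 0 else qterm k n + (if n < Suc k then 0 else qterm (Suc k) n)) =
       (if n < k then 0 else X ^ k * h (n - k))"
    proof (cases "n < k")
      case False
      hence n: "n \<ge> k" by simp
      have 1: "(k choose 2) + (k + 1) * n = k + C + (k + 1) * (n - k)"
        using n by (auto simp: C_def algebra_simps le_iff_add)
      have 2: "(k choose 2) + (k + 1) * n + n = k + (C + k) + (k + 2) * (n - k)"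
        using n by (auto simp: C_def algebra_simps le_iff_add)
      have "qf k * (if n < k then 0 else qterm k n + (if n < Suc k then 0 else qterm (Suc k) n)) =
          X ^ ((k choose 2) + (k + 1) * n) * (1 - X ^ k + X ^ n) * inverse (qf (n - k))"
        using qterm_add[OF k n] n by simp
      also have "\<dots> = X ^ ((k choose 2) + (k + 1) * n) * (1 - X ^ k) * inverse (qf (n - k)) +
           X ^ ((k choose 2) + (k + 1) * n + n) * inverse (qf (n - k))"
        by (simp add: power_add algebra_simps)
      also have "\<dots> = X ^ k * h (n - k)"
        unfolding 2 unfolding 1 h_def g_def g'_def by (simp only: power_add distrib_left mult_ac)
      finally show ?thesis using n by simp
    qed auto
  qed
  also have "fsum \<dots> = X ^ k * fsum h"
    by (rule fsum_shift) (rule zh)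
  also have "fsum h = X ^ C * (1 - X ^ k) * fsum g + X ^ (C + k) * fsum g'"
    unfolding h_def fsum_add by (simp only: fsum_mult_left[OF z(1)] fsum_mult_left[OF z(2)])
  also have "fsum g = euler_sum (k + 1)" by (simp add: g_def euler_sum_def)
  also have "fsum g' = (1 - X ^ (k + 1)) * euler_sum (k + 1)"
    using euler_sum_Suc[of "k + 1"] by (simp add: g'_def euler_sum_def)
  also have "X ^ k * (X ^ C * (1 - X ^ k) * euler_sum (k + 1) +
       X ^ (C + k) * ((1 - X ^ (k + 1)) * euler_sum (k + 1))) =
       X ^ (C + k) * (1 - X ^ (2 * k + 1)) * euler_sum (k + 1)"
  proof -
    \<comment> \<open>Used as (1 - q^k) + q^k (1 - q^(k+1)) = 1 - q^(2k+1).\<close>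
    have e: "X ^ (2 * k + 1) = X ^ k * X ^ (k + 1)" by (simp only: power_add mult_2 mult.assoc)
    show ?thesis unfolding e power_add[of X C k] by (simp only: algebra_simps mult_1_left mult_1_right)
  qed
  also have "X ^ (C + k) = X ^ pent_nat k"
    unfolding pent_nat_eq[symmetric] C_def by (simp add: algebra_simps)
  finally have "euler * (qf k * (qseries k + qseries (Suc k))) =
      X ^ pent_nat k * (1 - X ^ (2 * k + 1)) * (euler * euler_sum (k + 1))"
    by simp
  hence "qf k * (euler * qseries k + euler * qseries (Suc k)) = qf k * pent_pair k"
    unfolding euler_euler_sum pent_pair_def by (simp add: algebra_simps)
  thus ?thesis by simp
qed

section \<open>Alternating sums of a quadratic quasi-polynomial\<close>

definition pent :: "int \<Rightarrow> int" where "pent j = j * (3 * j + 1) div 2"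

lemma two_pent: "2 * pent j = j * (3 * j + 1)"
proof -
  have "even (j * (3 * j + 1))" by auto
  thus ?thesis by (simp add: pent_def)
qed

lemma pent_add1: "pent (j + 1) = pent j + 3 * j + 2"
  using two_pent[of j] two_pent[of "j + 1"] by (simp add: algebra_simps)

lemma pent_mono: assumes "0 \<le> i" "i \<le> j" shows "pent i \<le> pent j"
proof -
  have "i * (3 * i + 1) \<le> j * (3 * j + 1)" using assms by (intro mult_mono) auto
  thus ?thesis using two_pent[of i] two_pent[of j] by simp
qed

text \<open>Shows that indices \<open>j > n\<close> contribute nothing, so that
  \<open>altsum\<close> may stop at \<open>j = n\<close>.\<close>

lemma pent_ge: "0 \<le> j \<Longrightarrow> j \<le> pent j"
proof (cases "j = 0")
  case False
  assume "0 \<le> j"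
  hence "1 * j \<le> j * j" using False by (intro mult_right_mono) auto
  moreover have "2 * pent j = 3 * (j * j) + j"
    unfolding two_pent by (simp add: algebra_simps)
  ultimately show ?thesis using \<open>0 \<le> j\<close> by linarith
qed (simp add: pent_def)

text \<open>Up to the factor \<open>2 * M\<close>, the coefficients of $1/((1-q^a)(1-q^b)(1-q^c))$ for pairwise coprime
  $a, b, c$ with $M = abc$ and $\sigma = a+b+c$ have this form, with \<open>e\<close> of period $M$. The term
  \<open>pent_step \<sigma> e n j\<close> is the coefficient of $q^n$ after multiplication by $q^{j(3j+1)/2}(1-q^{2j+1})$.\<close>

definition quasi_val :: "int \<Rightarrow> (int \<Rightarrow> int) \<Rightarrow> int \<Rightarrow> int"
  where "quasi_val \<sigma> e n = (if n < 0 then 0 else n * n + \<sigma> * n + e n)"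

definition pent_step :: "int \<Rightarrow> (int \<Rightarrow> int) \<Rightarrow> int \<Rightarrow> int \<Rightarrow> int"
  where "pent_step \<sigma> e n j = quasi_val \<sigma> e (n - pent j) - quasi_val \<sigma> e (n - pent j - 2 * j - 1)"

text \<open>For suitable \<open>e\<close>, this is \<open>2 * M\<close> times the coefficient of q^n
  in (q;q)_inf S(k) divided by the three factors. The sign is normalised to +1 at
  \<open>j = k\<close>.\<close>

definition altsum :: "int \<Rightarrow> (int \<Rightarrow> int) \<Rightarrow> nat \<Rightarrow> int \<Rightarrow> int"
  where "altsum \<sigma> e k n = (\<Sum>j\<in>{k..<nat n + 1}. (-1) ^ (k + j) * pent_step \<sigma> e n (int j))"

text \<open>The share of the periodic part \<open>e\<close> in \<open>pent_step\<close> when neither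
  argument is cut off.\<close>

definition osc :: "(int \<Rightarrow> int) \<Rightarrow> int \<Rightarrow> int \<Rightarrow> int"
  where "osc e n j = e (n - pent j) - e (n - pent j - 2 * j - 1)"

definition osc_sum :: "(int \<Rightarrow> int) \<Rightarrow> int \<Rightarrow> nat \<Rightarrow> int"
  where "osc_sum e n m = (\<Sum>i<m. (-1) ^ i * osc e n (int i))"

lemma pent_step_eq_0: "0 \<le> j \<Longrightarrow> n < pent j \<Longrightarrow> pent_step \<sigma> e n j = 0"
  by (simp add: pent_step_def quasi_val_def)

lemma altsum_eq_0: assumes "n < pent (int k)" shows "altsum \<sigma> e k n = 0"
  unfolding altsum_def
proof (rule sum.neutral, rule ballI)
  fix j assume "j \<in> {k..<nat n + 1}"
  hence "n < pent (int j)" using pent_mono[of "int k" "int j"] assms by simp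
  thus "(-1) ^ (k + j) * pent_step \<sigma> e n (int j) = 0" by (simp add: pent_step_eq_0)
qed

text \<open>The same recurrence in \<open>k\<close> as that of (q;q)_inf S(k); it serves both to
  identify the two and to evaluate the sums.\<close>

lemma altsum_rec: "altsum \<sigma> e k n = pent_step \<sigma> e n (int k) - altsum \<sigma> e (Suc k) n"
proof (cases "k < nat n + 1")
  case True
  have "altsum \<sigma> e k n = pent_step \<sigma> e n (int k) +
      (\<Sum>j\<in>{Suc k..<nat n + 1}. (-1) ^ (k + j) * pent_step \<sigma> e n (int j))"
    unfolding altsum_def using True by (subst sum.atLeast_Suc_lessThan) (auto simp: mult_2[symmetric])
  also have "(\<Sum>j\<in>{Suc k..<nat n + 1}. (-1) ^ (k + j) * pent_step \<sigma> e n (int j)) = - altsum \<sigma> e (Suc k) n"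
    unfolding altsum_def by (simp add: sum_negf)
  finally show ?thesis by simp
next
  case False
  hence "n < pent (int k)" using pent_ge[of "int k"] by linarith
  moreover from this have "n < pent (int (Suc k))" using pent_mono[of "int k" "int (Suc k)"] by simp
  ultimately show ?thesis by (simp only: altsum_eq_0 pent_step_eq_0 of_nat_0_le_iff)
qed

text \<open>Keeps the last contributing index \<open>J\<close> apart, because among these indices
  only \<open>J\<close> can have a negative second argument in \<open>pent_step\<close>.\<close>

lemma altsum_eq_sum_atMost:
  assumes "pent (int J) \<le> n" "n < pent (int J + 1)" "k \<le> J"
  shows   "altsum \<sigma> e k n = (\<Sum>j\<in>{k..<J}. (-1) ^ (k + j) * pent_step \<sigma> e n (int j)) +
             (-1) ^ (k + J) * pent_step \<sigma> e n (int J)"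
proof -
  have J: "J < nat n + 1" using pent_ge[of "int J"] assms(1) by linarith
  have "altsum \<sigma> e k n = (\<Sum>j\<in>{k..<Suc J}. (-1) ^ (k + j) * pent_step \<sigma> e n (int j))"
    unfolding altsum_def
  proof (rule sum.mono_neutral_right)
    show "\<forall>j\<in>{k..<nat n + 1} - {k..<Suc J}. (-1) ^ (k + j) * pent_step \<sigma> e n (int j) = 0"
    proof
      fix j assume "j \<in> {k..<nat n + 1} - {k..<Suc J}"
      hence "pent (int J + 1) \<le> pent (int j)" using assms(3) by (intro pent_mono) auto
      thus "(-1) ^ (k + j) * pent_step \<sigma> e n (int j) = 0" using assms(2) by (simp add: pent_step_eq_0)
    qed
  qed (use J in auto)
  thus ?thesis using assms(3) by simp
qed

lemma neg_one_power_cases: "(-1 :: int) ^ m = 1 \<or> (-1 :: int) ^ m = -1"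
  by (cases "even m") auto

text \<open>The assumption \<open>window\<close> says that the quasi-polynomial vanishes on the gap between \<open>- \<sigma>\<close> and \<open>0\<close>, so
  that cutting it off at \<open>0\<close> has no effect above \<open>- \<sigma>\<close>. The numerical constants are chosen so as to cover
  both \<open>M = 36, \<sigma> = 14\<close> and \<open>M = 42, \<sigma> = 12\<close>.\<close>

locale quasi_quadratic =
  fixes M \<sigma> :: int and e :: "int \<Rightarrow> int"
  assumes M: "M > 0"
    and sigma: "12 \<le> \<sigma>" "\<sigma> \<le> 14"
    and periodic: "e (n mod M) = e n"
    and e_bounds: "- 13 \<le> e n" "e n \<le> 84"
    and e_0: "e 0 \<ge> 0"
    and window: "- \<sigma> < n \<Longrightarrow> n < 0 \<Longrightarrow> n * n + \<sigma> * n + e n = 0"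
    and osc_sum_period: "0 \<le> n \<Longrightarrow> n < M \<Longrightarrow> osc_sum e n (nat (2 * M)) = 0"
    and osc_sum_bound: "0 \<le> n \<Longrightarrow> n < M \<Longrightarrow> m \<le> nat (2 * M) \<Longrightarrow> \<bar>osc_sum e n m\<bar> \<le> 132"
begin

abbreviation "Q \<equiv> quasi_val \<sigma> e"
abbreviation "D \<equiv> pent_step \<sigma> e"

lemma e_cong: "x mod M = y mod M \<Longrightarrow> e x = e y"
  by (metis periodic)

lemma quasi_val_eq: "- \<sigma> < n \<Longrightarrow> Q n = n * n + \<sigma> * n + e n"
  using window[of n] by (auto simp: quasi_val_def)

text \<open>For \<open>n \<ge> 1\<close> the quadratic part is at least 1 + 12, which offsets the
  lower bound -13 on \<open>e\<close>.\<close>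

lemma quasi_val_nonneg: "Q n \<ge> 0"
proof (cases "n \<le> 0")
  case True
  thus ?thesis using e_0 by (cases "n = 0") (auto simp: quasi_val_def)
next
  case False
  hence "n * n + \<sigma> * n \<ge> 1 * 1 + 12 * 1" using sigma by (intro add_mono mult_mono) auto
  thus ?thesis using e_bounds[of n] False by (simp add: quasi_val_def)
qed

section \<open>Periodicity and boundedness of the oscillating part\<close>

lemma osc_mod: "osc e (n mod M) j = osc e n j"
proof -
  have "e (n mod M - c) = e (n - c)" for c
    by (intro e_cong) (rule mod_diff_left_eq)
  thus ?thesis unfolding osc_def diff_diff_eq by simp
qed

lemma osc_sum_mod: "osc_sum e (n mod M) m = osc_sum e n m"
  unfolding osc_sum_def osc_mod ..

text \<open>Shifting \<open>j\<close> by \<open>2 * M\<close> changes \<open>pent j\<close> by a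
  multiple of \<open>M\<close>; because of the division by 2 in \<open>pent\<close>, a shift by
  \<open>M\<close> need not.\<close>

lemma osc_periodic: "osc e n (j + 2 * M) = osc e n j"
proof -
  have p: "pent (j + 2 * M) = pent j + M * (6 * M + 6 * j + 1)"
    using two_pent[of j] two_pent[of "j + 2 * M"] by (simp add: algebra_simps)
  have "(n - pent (j + 2 * M)) mod M = (n - pent j + M * (- (6 * M + 6 * j + 1))) mod M"
    unfolding p by (simp add: algebra_simps)
  hence 1: "e (n - pent (j + 2 * M)) = e (n - pent j)"
    by (intro e_cong) (simp only: mod_mult_self2)
  have "(n - pent (j + 2 * M) - 2 * (j + 2 * M) - 1) mod M =
      (n - pent j - 2 * j - 1 + M * (- (6 * M + 6 * j + 5))) mod M"
    unfolding p by (simp add: algebra_simps)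
  hence 2: "e (n - pent (j + 2 * M) - 2 * (j + 2 * M) - 1) = e (n - pent j - 2 * j - 1)"
    by (intro e_cong) (simp only: mod_mult_self2)
  show ?thesis unfolding osc_def 1 2 ..
qed

text \<open>A full period sums to zero and has even length \<open>2 * M\<close>, so it can be split
  off without changing the signs of the rest.\<close>

lemma abs_osc_sum_le: "\<bar>osc_sum e n m\<bar> \<le> 132"
proof (induction m rule: less_induct)
  case (less m)
  define p where "p = nat (2 * M)"
  have p: "int p = 2 * M" "p > 0" "even p" using M by (auto simp: p_def even_nat_iff)
  show ?case
  proof (cases "m \<le> p")
    case True
    thus ?thesis using osc_sum_bound[of "n mod M" m] M unfolding osc_sum_mod p_def by simp
  next
    case False
    then obtain l where l: "m = p + l" by (metis le_iff_add nat_le_linear)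
    have "osc_sum e n (p + l) = osc_sum e n p + (\<Sum>i<l. (-1) ^ (p + i) * osc e n (int (p + i)))"
    proof (induction l)
      case (Suc l)
      thus ?case by (simp add: osc_sum_def)
    qed (simp add: osc_sum_def)
    also have "osc_sum e n p = 0"
      using osc_sum_period[of "n mod M"] M unfolding osc_sum_mod p_def by simp
    also have "(\<Sum>i<l. (-1) ^ (p + i) * osc e n (int (p + i))) = osc_sum e n l"
      unfolding osc_sum_def
    proof (rule sum.cong)
      fix i
      have "int (p + i) = int i + 2 * M" using p by simp
      thus "(-1) ^ (p + i) * osc e n (int (p + i)) = (-1) ^ i * osc e n (int i)"
        using p by (simp only: osc_periodic power_add) simp
    qed auto
    finally show ?thesis using less.IH[of l] l p by simp
  qed
qed

text \<open>The quadratic part of the summand is a cubic in \<open>2 * j + 1\<close>, and an alternating sum of cubics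
  telescopes.\<close>

definition main_part :: "int \<Rightarrow> nat \<Rightarrow> int"
  where "main_part n j = (-1) ^ j * (int j * (2 * n + \<sigma> + 2 - 3 * int j * int j))"

lemma step_telescope:
  assumes "n - pent (int j) - 2 * int j - 1 > - \<sigma>"
  shows   "(-1) ^ j * D n (int j) = (main_part n j - main_part n (Suc j)) + (osc_sum e n (Suc j) - osc_sum e n j)"
proof -
  define p where "p = pent (int j)"
  define i where "i = int j"
  have p: "2 * p = i * (3 * i + 1)" unfolding p_def i_def by (rule two_pent)
  have i: "i \<ge> 0" by (simp add: i_def)
  have "D n i = Q (n - p) - Q (n - p - 2 * i - 1)"
    unfolding pent_step_def p_def i_def ..
  also have "Q (n - p) = (n - p) * (n - p) + \<sigma> * (n - p) + e (n - p)"
    using assms i by (intro quasi_val_eq) (auto simp: p_def i_def)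
  also have "Q (n - p - 2 * i - 1) = (n - p - 2 * i - 1) * (n - p - 2 * i - 1) + \<sigma> * (n - p - 2 * i - 1) + e (n - p - 2 * i - 1)"
    using assms by (intro quasi_val_eq) (auto simp: p_def i_def)
  finally have "D n i = (2 * i + 1) * (2 * n - 2 * p - 2 * i - 1 + \<sigma>) + osc e n i"
    by (simp add: osc_def p_def i_def algebra_simps)
  \<comment> \<open>The cubic is g(i) + g(i + 1) for g(x) = x (2n + \<sigma> + 2 - 3x^2), so the
    alternating sign turns it into a difference of consecutive values of
    \<open>main_part\<close>.\<close>
  also have "(2 * i + 1) * (2 * n - 2 * p - 2 * i - 1 + \<sigma>) =
     i * (2 * n + \<sigma> + 2 - 3 * i * i) + (i + 1) * (2 * n + \<sigma> + 2 - 3 * (i + 1) * (i + 1))"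
    unfolding p by (simp add: algebra_simps)
  finally have "(-1) ^ j * D n i = (-1) ^ j * (i * (2 * n + \<sigma> + 2 - 3 * i * i)) +
      (-1) ^ j * ((i + 1) * (2 * n + \<sigma> + 2 - 3 * (i + 1) * (i + 1))) + (-1) ^ j * osc e n i"
    by (simp only: distrib_left)
  moreover have "int (Suc j) = i + 1" by (simp add: i_def)
  ultimately show ?thesis
    unfolding main_part_def osc_sum_def by (simp add: i_def[symmetric] del: of_nat_Suc)
qed

lemma sum_step_telescope:
  assumes "\<And>j. k \<le> j \<Longrightarrow> j < m \<Longrightarrow> n - pent (int j) - 2 * int j - 1 > - \<sigma>" "k \<le> m"
  shows   "(\<Sum>j\<in>{k..<m}. (-1) ^ (k + j) * D n (int j)) =
     (-1) ^ k * ((main_part n k - main_part n m) + (osc_sum e n m - osc_sum e n k))"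
proof -
  have "(\<Sum>j\<in>{k..<m}. (-1) ^ (k + j) * D n (int j)) = (-1) ^ k * (\<Sum>j\<in>{k..<m}. (-1) ^ j * D n (int j))"
    by (simp add: sum_distrib_left power_add mult.assoc)
  also have "(\<Sum>j\<in>{k..<m}. (-1) ^ j * D n (int j)) =
     (\<Sum>j\<in>{k..<m}. (osc_sum e n (Suc j) - main_part n (Suc j)) - (osc_sum e n j - main_part n j))"
    by (intro sum.cong refl, subst step_telescope) (use assms in auto)
  also have "\<dots> = (osc_sum e n m - main_part n m) - (osc_sum e n k - main_part n k)"
    using assms(2) by (rule sum_Suc_diff')
  finally show ?thesis by (simp add: algebra_simps)
qed

text \<open>The bound \<open>495\<close> is \<open>pent 18\<close>: with \<open>J\<close> the last index that contributes, the main part is at least of order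
  \<open>J * J\<close>, which exceeds the bounded oscillating part from \<open>J = 18\<close> on.\<close>

lemma altsum_nonneg_large:
  assumes k: "k > 0" and n: "n \<ge> 495"
  shows   "altsum \<sigma> e k n \<ge> 0"
proof -
  have ex: "\<exists>J. n < pent (int J + 1)"
    using pent_ge[of "int (nat n) + 1"] n by (intro exI[of _ "nat n"]) auto
  \<comment> \<open>The last index with \<open>pent J \<le> n\<close>; all later summands
    vanish.\<close>
  define J where "J = (LEAST J. n < pent (int J + 1))"
  have J2: "n < pent (int J + 1)" unfolding J_def by (rule LeastI_ex[OF ex])
  have J18: "J \<ge> 18"
  proof (rule ccontr)
    assume "\<not> J \<ge> 18"
    hence "pent (int J + 1) \<le> pent 18" by (intro pent_mono) auto
    thus False using J2 n by (simp add: pent_def)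
  qed
  have J1: "pent (int J) \<le> n"
  proof (rule ccontr)
    assume "\<not> pent (int J) \<le> n"
    moreover have "int (J - 1) + 1 = int J" using J18 by simp
    ultimately have "n < pent (int (J - 1) + 1)" by simp
    from Least_le[of "\<lambda>J. n < pent (int J + 1)", OF this] show False using J18 unfolding J_def[symmetric] by simp
  qed
  define i where "i = int J"
  define r where "r = n - pent i"
  define \<kappa> where "\<kappa> = int k"
  \<comment> \<open>In terms of \<open>L\<close>, the boundary term \<open>main_part n j\<close> is
    j (L - 3j^2) up to sign.\<close>
  define L where "L = 2 * n + \<sigma> + 2"
  have i18: "i \<ge> 18" using J18 by (simp add: i_def)
  have r: "0 \<le> r" "r \<le> 3 * i + 1" using J1 J2 pent_add1[of i] by (auto simp: r_def i_def)
  have L: "L = 3 * i * i + i + 2 * r + \<sigma> + 2" using two_pent[of i] by (simp add: L_def r_def algebra_simps)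
  \<comment> \<open>Before \<open>J\<close> the cut-off has no effect:
    \<open>pent (j + 1) \<le> n\<close> makes even the smaller argument positive.\<close>
  have below: "n - pent (int j) - 2 * int j - 1 > - \<sigma>" if "j < J" for j
  proof -
    have "pent (int j + 1) \<le> pent i" using that by (intro pent_mono) (auto simp: i_def)
    thus ?thesis using r(1) pent_add1[of "int j"] sigma by (simp add: r_def)
  qed
  have osc: "\<bar>osc_sum e n a - osc_sum e n b\<bar> \<le> 264" for a b
    using abs_osc_sum_le[of n a] abs_osc_sum_le[of n b] by linarith
  \<comment> \<open>The two sides differ by (\<kappa> - 1) (L - 3 (\<kappa>^2 + \<kappa> + 1)), so
    the lower boundary term is smallest at \<open>k = 1\<close>.\<close>
  have head: "\<kappa> * (L - 3 * \<kappa> * \<kappa>) \<ge> L - 3" if "k < J"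
  proof -
    have k': "1 \<le> \<kappa>" "\<kappa> \<le> i - 1" using k that by (auto simp: \<kappa>_def i_def)
    have "\<kappa> * \<kappa> \<le> (i - 1) * (i - 1)" using k' by (intro mult_mono) auto
    hence "L - 3 * (\<kappa> * \<kappa> + \<kappa> + 1) \<ge> 0"
      unfolding L using k' sigma r i18 by (simp add: algebra_simps)
    hence "(\<kappa> - 1) * (L - 3 * (\<kappa> * \<kappa> + \<kappa> + 1)) \<ge> 0" using k' by simp
    thus ?thesis by (simp add: algebra_simps)
  qed
  \<comment> \<open>For \<open>r \<le> 2 * i\<close> the second value at \<open>J\<close> is cut off
    and only \<open>Q r\<close> remains; for \<open>r > 2 * i\<close> the pair at \<open>J\<close>
    is complete and telescopes too.\<close>
  consider "k > J" | "k = J" "r \<le> 2 * i" | "k = J" "r > 2 * i" | "k < J" "r \<le> 2 * i" | "k < J" "r > 2 * i"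
    by linarith
  thus ?thesis
  proof cases
    case 1
    hence "pent (int J + 1) \<le> pent (int k)" by (intro pent_mono) auto
    thus ?thesis using J2 by (subst altsum_eq_0) auto
  next
    case 2
    have "altsum \<sigma> e k n = D n i"
      unfolding altsum_eq_sum_atMost[OF J1 J2, of k, simplified 2, simplified] 2 i_def
      by (simp add: mult_2[symmetric])
    also have "\<dots> = Q r" using 2 by (simp add: pent_step_def r_def quasi_val_def)
    finally show ?thesis using quasi_val_nonneg[of r] by simp
  next
    case 3
    have "altsum \<sigma> e k n = D n i"
      unfolding altsum_eq_sum_atMost[OF J1 J2, of k, simplified 3, simplified] 3 i_def
      by (simp add: mult_2[symmetric])
    also have "\<dots> = (r * r + \<sigma> * r + e r) - ((r - 2*i - 1) * (r - 2*i - 1) + \<sigma> * (r - 2*i-1) + e (r - 2*i-1))"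
      using 3 r(1) by (simp add: pent_step_def r_def quasi_val_def)
    also have "\<dots> = (2 * i + 1) * (2 * r - 2 * i - 1 + \<sigma>) + e r - e (r - 2*i-1)"
      by (simp add: algebra_simps)
    finally have "altsum \<sigma> e k n = (2 * i + 1) * (2 * r - 2 * i - 1 + \<sigma>) + e r - e (r - 2*i-1)" .
    moreover have "37 * 10 \<le> (2 * i + 1) * (2 * r - 2 * i - 1 + \<sigma>)"
      using 3 i18 sigma by (intro mult_mono) auto
    ultimately show ?thesis using e_bounds[of r] e_bounds[of "r - 2*i-1"] by simp
  next
    case 4
    have "altsum \<sigma> e k n = (-1) ^ k * ((main_part n k - main_part n J) + (osc_sum e n J - osc_sum e n k)) +
       (-1) ^ (k + J) * D n i"
      using altsum_eq_sum_atMost[OF J1 J2, of k] sum_step_telescope[of k J n] below 4 by (simp add: i_def)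
    also have "D n i = Q r" using 4 by (simp add: pent_step_def r_def quasi_val_def)
    finally have *: "altsum \<sigma> e k n = \<kappa> * (L - 3 * \<kappa> * \<kappa>) +
        (-1) ^ k * (osc_sum e n J - osc_sum e n k) - (-1) ^ (k + J) * (i * (L - 3 * i * i) - Q r)"
      by (simp add: main_part_def L_def i_def \<kappa>_def algebra_simps power_add)
    \<comment> \<open>The upper boundary term minus \<open>Q r\<close> has to lie between -84 and
      \<open>L - 267\<close>, where 267 = 3 + 264 collects the losses from \<open>head\<close> and
      \<open>osc\<close>. Written in \<open>t\<close>, the upper estimate reduces to completing a
      square.\<close>
    define t where "t = i - r"
    have t: "- i \<le> t" "t \<le> i" using 4 r by (auto simp: t_def)
    have Qr: "Q r = r * r + \<sigma> * r + e r" using r(1) sigma by (intro quasi_val_eq) auto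
    have q: "i * (L - 3 * i * i) - Q r = i * i + 2 * i + r * (2 * i - r) + \<sigma> * t - e r"
      unfolding Qr L t_def by (simp add: algebra_simps)
    have ii: "i * i \<ge> 18 * i" using i18 by (intro mult_right_mono) auto
    have st: "\<sigma> * t \<ge> - (14 * i)"
    proof -
      have "\<sigma> * (- t) \<le> \<sigma> * i" using t sigma by (intro mult_left_mono) auto
      also have "\<sigma> * i \<le> 14 * i" using i18 sigma by (intro mult_right_mono) auto
      finally show ?thesis by simp
    qed
    have "r * (2 * i - r) \<ge> 0" using r 4 by simp
    hence q1: "i * (L - 3 * i * i) - Q r \<ge> - 84" unfolding q using ii st e_bounds[of r] i18 by linarith
    have "L - 267 - (i * (L - 3 * i * i) - Q r) = i * i + i + (t * t - (2 + \<sigma>) * t) + \<sigma> - 265 + e r"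
      unfolding q unfolding L t_def by (simp add: algebra_simps)
    moreover have "t * t - (2 + \<sigma>) * t \<ge> - 64"
    proof -
      \<comment> \<open>The minima over real \<open>t\<close> are -49, -56.25 and -64,
        respectively.\<close>
      have "\<sigma> = 12 \<or> \<sigma> = 13 \<or> \<sigma> = 14" using sigma by auto
      moreover have "(t - 7) * (t - 7) \<ge> 0" "(t - 8) * (t - 8) \<ge> 0" "(2 * t - 15) * (2 * t - 15) \<ge> 0" by simp_all
      ultimately show ?thesis by (auto simp: algebra_simps)
    qed
    ultimately have q2: "i * (L - 3 * i * i) - Q r \<le> L - 267"
      using ii i18 sigma e_bounds[of r] by linarith
    have "L \<ge> 1000" using n sigma by (simp add: L_def)
    thus ?thesis unfolding * using head[OF 4(1)] osc[of J k] q1 q2 neg_one_power_cases[of k] neg_one_power_cases[of "k + J"] by auto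
  next
    case 5
    have "altsum \<sigma> e k n = (\<Sum>j\<in>{k..<Suc J}. (-1) ^ (k + j) * D n (int j))"
      using altsum_eq_sum_atMost[OF J1 J2, of k] 5 by simp
    also have "\<dots> = (-1) ^ k * ((main_part n k - main_part n (Suc J)) + (osc_sum e n (Suc J) - osc_sum e n k))"
    proof (rule sum_step_telescope)
      fix j assume "j < Suc J"
      thus "n - pent (int j) - 2 * int j - 1 > - \<sigma>"
        using below[of j] 5 sigma by (cases "j = J") (auto simp: r_def i_def)
    qed (use 5 in auto)
    finally have *: "altsum \<sigma> e k n = \<kappa> * (L - 3 * \<kappa> * \<kappa>) +
        (-1) ^ k * (osc_sum e n (Suc J) - osc_sum e n k) + (-1) ^ (k + J) * ((i + 1) * (L - 3 * (i + 1) * (i + 1)))"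
      by (simp add: main_part_def L_def i_def \<kappa>_def algebra_simps power_add)
    \<comment> \<open>The second factor lies between \<open>- i\<close> and \<open>i + 15\<close>,
      so the boundary term is about i^2 at most in absolute value, while \<open>L\<close> is at
      least about 3i^2.\<close>
    have q: "(i + 1) * (L - 3 * (i + 1) * (i + 1)) = (i + 1) * (2 * r + \<sigma> - 1 - 5 * i)"
      unfolding L by (simp add: algebra_simps)
    have ii: "i * i \<ge> 18 * i" using i18 by (intro mult_right_mono) auto
    have ee: "(i + 1) * (i + 15) = i * i + 16 * i + 15" "(i + 1) * (- i) = - (i * i) - i"
      by (simp_all add: algebra_simps)
    define z where "z = (i + 1) * (2 * r + \<sigma> - 1 - 5 * i)"
    have "z \<le> (i + 1) * (i + 15)"
      unfolding z_def using r sigma i18 by (intro mult_left_mono) auto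
    moreover have "z \<ge> (i + 1) * (- i)"
      unfolding z_def using 5 sigma i18 by (intro mult_left_mono) auto
    moreover have "L \<ge> 3 * (i * i) + 5 * i + 16" unfolding L using 5 sigma by simp
    ultimately have z: "z \<le> L - 267" "- z \<le> L - 267"
      using ii i18 unfolding ee by linarith+
    hence "\<bar>(i + 1) * (L - 3 * (i + 1) * (i + 1))\<bar> \<le> L - 267"
      unfolding q z_def by (simp add: abs_le_iff)
    thus ?thesis unfolding * using head[OF 5(1)] osc[of "Suc J" k] neg_one_power_cases[of k] neg_one_power_cases[of "k + J"] by auto
  qed
qed

end

section \<open>The parts 1, 4, 9 and 2, 3, 7\<close>

primrec nth_int :: "int list \<Rightarrow> int \<Rightarrow> int" where
  "nth_int [] n = 0"
| "nth_int (x # xs) n = (if n = 0 then x else nth_int xs (n - 1))"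

text \<open>The tables are \<open>2 * M * c n - n * n - \<sigma> * n\<close> for \<open>0 \<le> n < M\<close>, where \<open>c n\<close> counts the partitions of \<open>n\<close>
  into parts 1, 4, 9 and into parts 2, 3, 7, respectively.\<close>

definition osc_1_4_9 :: "int \<Rightarrow> int" where
  "osc_1_4_9 n = nth_int [72, 57, 40, 21, 72, 49, 24, -3, 40, 81, 48, 13, 48, 81, 40, -3, 24, 49, 72, 21, 40, 57, 72, 13,
     24, 33, 40, 45, 48, 49, 48, 45, 40, 33, 24, 13] (n mod 36)"

definition osc_2_3_7 :: "int \<Rightarrow> int" where
  "osc_2_3_7 n = nth_int [84, -13, 56, 39, 20, -1, 60, 35, 8, 63, 32, -1, 48, 11, 56, 15, 56, 11, 48, -1, 32, 63, 8, 35, 60,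
     -1, 20, 39, 56, -13, 84, 11, 20, 27, 32, 35, 36, 35, 32, 27, 20, 11] (n mod 42)"

text \<open>Here \<open>a\<close> carries the current partial sum, and \<open>b\<close> is true at
  even positions, where the sign is plus. One pass tests the bound on every partial sum and the
  vanishing of the total.\<close>

primrec check_osc :: "(int \<Rightarrow> int) \<Rightarrow> int \<Rightarrow> bool \<Rightarrow> int \<Rightarrow> int list \<Rightarrow> bool" where
  "check_osc e n b a [] \<longleftrightarrow> a = 0"
| "check_osc e n b a (j # js) \<longleftrightarrow> \<bar>a\<bar> \<le> 132 \<and>
     check_osc e n (\<not> b) (if b then a + osc e n j else a - osc e n j) js"

lemma check_osc_imp:
  assumes "check_osc e n (even l) (osc_sum e n l) [int l..int N - 1]" "l \<le> N"
  shows   "osc_sum e n N = 0 \<and> (\<forall>m\<in>{l..N}. \<bar>osc_sum e n m\<bar> \<le> 132)"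
  using assms
proof (induction "N - l" arbitrary: l)
  case 0
  hence "l = N" by auto
  thus ?case using 0 by simp
next
  case (Suc d)
  hence l: "l < N" by simp
  have "[int l..int N - 1] = int l # [int (Suc l)..int N - 1]"
    using l by (subst upto_rec1) (auto simp: add.commute)
  hence *: "\<bar>osc_sum e n l\<bar> \<le> 132" "check_osc e n (even (Suc l)) (osc_sum e n (Suc l)) [int (Suc l)..int N - 1]"
    using Suc.prems(1) by (auto simp: osc_sum_def split: if_splits)
  have IH: "osc_sum e n N = 0 \<and> (\<forall>m\<in>{Suc l..N}. \<bar>osc_sum e n m\<bar> \<le> 132)"
    by (rule Suc.hyps(1)) (use *(2) Suc.hyps(2) l in auto)
  moreover have "{l..N} = insert l {Suc l..N}" using l by auto
  ultimately show ?case using *(1) by simp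
qed

text \<open>One period of length 36 in \<open>n\<close> and one of length 72 in \<open>j\<close> are
  covered.\<close>

lemma check_osc_1_4_9: "list_all (\<lambda>n. check_osc osc_1_4_9 n True 0 [0..71]) [0..35]"
  by code_simp

lemma check_osc_2_3_7: "list_all (\<lambda>n. check_osc osc_2_3_7 n True 0 [0..83]) [0..41]"
  by code_simp

section \<open>Evaluation below the bound 495\<close>

primrec check_altsum :: "int \<Rightarrow> (int \<Rightarrow> int) \<Rightarrow> int \<Rightarrow> int list \<Rightarrow> int \<Rightarrow> int list \<Rightarrow> bool" where
  "check_altsum \<sigma> e n ex a [] \<longleftrightarrow> a \<ge> 0 \<or> n \<in> set ex"
| "check_altsum \<sigma> e n ex a (j # js) \<longleftrightarrow> a \<ge> 0 \<and> check_altsum \<sigma> e n ex (pent_step \<sigma> e n j - a) js"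

text \<open>Descends by \<open>altsum_rec\<close> from \<open>k = 18\<close>, where the sum is 0
  because \<open>pent 18 = 495\<close>. The exceptional \<open>n\<close> are tolerated only at the
  final value, \<open>k = 1\<close>.\<close>

lemma check_altsum_1_4_9: "list_all (\<lambda>n. check_altsum 14 osc_1_4_9 n [9,35] 0 (rev [1..17])) [0..494]"
  by code_simp

lemma check_altsum_2_3_7: "list_all (\<lambda>n. check_altsum 12 osc_2_3_7 n [7,13,127] 0 (rev [1..17])) [0..494]"
  by code_simp

definition altsum_1_code :: "int \<Rightarrow> (int \<Rightarrow> int) \<Rightarrow> int \<Rightarrow> int"
  where "altsum_1_code \<sigma> e n = fold (\<lambda>j a. pent_step \<sigma> e n j - a) (rev [1..17]) 0"

text \<open>The coefficients of $f/(1-q^p)$, in a form that can be evaluated.\<close>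

definition quotient_nth :: "int \<Rightarrow> (int \<Rightarrow> int) \<Rightarrow> int \<Rightarrow> int"
  where "quotient_nth p f n = sum_list (map (\<lambda>i. f (n - p * i)) [0..n div p])"

text \<open>Dividing by 1 - q^6 adds to the exceptional values at 9 and 35 those 6 places
  lower.\<close>

lemma check_1_4_6_9:
  "altsum_1_code 14 osc_1_4_9 9 + altsum_1_code 14 osc_1_4_9 3 \<ge> 0 \<and>
   altsum_1_code 14 osc_1_4_9 35 + altsum_1_code 14 osc_1_4_9 29 \<ge> 0"
  by code_simp

text \<open>The range 14 to 21 is the base of an induction in steps of 8, and 119 = 127 - 8
  compensates the exception at 127.\<close>

lemma check_2_3_7_8:
  "list_all (\<lambda>n. quotient_nth 8 (altsum_1_code 12 osc_2_3_7) n \<ge> 0) [14..21] \<and>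
   altsum_1_code 12 osc_2_3_7 119 + altsum_1_code 12 osc_2_3_7 127 \<ge> 0"
  by code_simp

text \<open>All values here are 84 times the coefficients that they stand for.\<close>

lemma check_2_3_7_8_13:
  "list_all (\<lambda>n. quotient_nth 13 (quotient_nth 8 (altsum_1_code 12 osc_2_3_7)) n \<ge>
       (if n = 19 then 84 else if n < 22 then 0 else 168) \<or> n = 7 \<or> n = 13) [0..34] \<and>
   quotient_nth 13 (quotient_nth 8 (altsum_1_code 12 osc_2_3_7)) 7 = -84 \<and>
   quotient_nth 13 (quotient_nth 8 (altsum_1_code 12 osc_2_3_7)) 13 = -84 \<and>
   quotient_nth 13 (quotient_nth 8 (altsum_1_code 12 osc_2_3_7)) 1 = 0"
  by code_simp

text \<open>The bounds have to enclose 0, the default value of \<open>nth_int\<close> for indices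
  outside the list.\<close>

lemma nth_int_bounds:
  assumes "lo \<le> 0" "0 \<le> hi" "list_all (\<lambda>x. lo \<le> x \<and> x \<le> hi) xs"
  shows   "lo \<le> nth_int xs n" "nth_int xs n \<le> hi"
proof -
  have "lo \<le> nth_int xs n \<and> nth_int xs n \<le> hi"
    using assms by (induction xs arbitrary: n) auto
  thus "lo \<le> nth_int xs n" "nth_int xs n \<le> hi" by auto
qed

section \<open>Verification of the locale assumptions for the two tables\<close>

interpretation parts_1_4_9: quasi_quadratic 36 14 osc_1_4_9
proof
  show "osc_1_4_9 (n mod 36) = osc_1_4_9 n" for n by (simp add: osc_1_4_9_def)
  show "- 13 \<le> osc_1_4_9 n" "osc_1_4_9 n \<le> 84" for n
    unfolding osc_1_4_9_def by (rule nth_int_bounds[where lo = "-13" and hi = 84]; simp)+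
  show "0 \<le> osc_1_4_9 0" by code_simp
  show "n * n + 14 * n + osc_1_4_9 n = 0" if "- 14 < n" "n < 0" for n
  proof -
    have "list_all (\<lambda>n. n * n + 14 * n + osc_1_4_9 n = 0) [-13..-1]" by code_simp
    thus ?thesis using that by (simp add: list_all_iff)
  qed
  fix n :: int assume n: "0 \<le> n" "n < 36"
  have "check_osc osc_1_4_9 n (even 0) (osc_sum osc_1_4_9 n 0) [int 0..int 72 - 1]"
    using check_osc_1_4_9 n by (simp add: list_all_iff osc_sum_def)
  from check_osc_imp[OF this] show "osc_sum osc_1_4_9 n (nat (2 * 36)) = 0"
    "\<And>m. m \<le> nat (2 * 36) \<Longrightarrow> \<bar>osc_sum osc_1_4_9 n m\<bar> \<le> 132"
    by simp_all
qed auto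

interpretation parts_2_3_7: quasi_quadratic 42 12 osc_2_3_7
proof
  show "osc_2_3_7 (n mod 42) = osc_2_3_7 n" for n by (simp add: osc_2_3_7_def)
  show "- 13 \<le> osc_2_3_7 n" "osc_2_3_7 n \<le> 84" for n
    unfolding osc_2_3_7_def by (rule nth_int_bounds[where lo = "-13" and hi = 84]; simp)+
  show "0 \<le> osc_2_3_7 0" by code_simp
  show "n * n + 12 * n + osc_2_3_7 n = 0" if "- 12 < n" "n < 0" for n
  proof -
    have "list_all (\<lambda>n. n * n + 12 * n + osc_2_3_7 n = 0) [-11..-1]" by code_simp
    thus ?thesis using that by (simp add: list_all_iff)
  qed
  fix n :: int assume n: "0 \<le> n" "n < 42"
  have "check_osc osc_2_3_7 n (even 0) (osc_sum osc_2_3_7 n 0) [int 0..int 84 - 1]"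
    using check_osc_2_3_7 n by (simp add: list_all_iff osc_sum_def)
  from check_osc_imp[OF this] show "osc_sum osc_2_3_7 n (nat (2 * 42)) = 0"
    "\<And>m. m \<le> nat (2 * 42) \<Longrightarrow> \<bar>osc_sum osc_2_3_7 n m\<bar> \<le> 132"
    by simp_all
qed auto

section \<open>Sign of the alternating sums for all n, up to the exceptions\<close>

lemma check_altsum_imp:
  assumes "check_altsum \<sigma> e n ex (altsum \<sigma> e (Suc l) n) (rev [1..int l])" "k \<in> {1..Suc l}"
  shows   "altsum \<sigma> e k n \<ge> 0 \<or> k = 1 \<and> n \<in> set ex"
  using assms
proof (induction l)
  case (Suc l)
  have "[1..int (Suc l)] = [1..int l] @ [int (Suc l)]"
    using upto_rec2[of 1 "int (Suc l)"] by simp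
  hence "altsum \<sigma> e (Suc (Suc l)) n \<ge> 0"
    "check_altsum \<sigma> e n ex (altsum \<sigma> e (Suc l) n) (rev [1..int l])"
    using Suc.prems(1) altsum_rec[of \<sigma> e "Suc l" n] by auto
  thus ?case using Suc.IH Suc.prems(2) by (cases "k = Suc (Suc l)") auto
qed auto

lemma fold_step_altsum:
  "fold (\<lambda>j a. pent_step \<sigma> e n j - a) (rev [1..int l]) (altsum \<sigma> e (Suc l) n) = altsum \<sigma> e 1 n"
proof (induction l)
  case (Suc l)
  have "[1..int (Suc l)] = [1..int l] @ [int (Suc l)]"
    using upto_rec2[of 1 "int (Suc l)"] by simp
  thus ?case using Suc.IH altsum_rec[of \<sigma> e "Suc l" n] by simp
qed auto

lemma altsum_18: "n < 495 \<Longrightarrow> k \<ge> 18 \<Longrightarrow> altsum \<sigma> e k n = 0"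
  using pent_mono[of 18 "int k"] by (intro altsum_eq_0) (simp add: pent_def)

lemma altsum_1_eq_code: "n < 495 \<Longrightarrow> altsum \<sigma> e 1 n = altsum_1_code \<sigma> e n"
  using fold_step_altsum[of \<sigma> e n 17] altsum_18[of n 18 \<sigma> e] by (simp add: altsum_1_code_def)

lemma altsum_small:
  assumes "list_all (\<lambda>n. check_altsum \<sigma> e n ex 0 (rev [1..17])) [0..494]" "0 \<le> n" "n < 495" "k > 0"
  shows   "altsum \<sigma> e k n \<ge> 0 \<or> k = 1 \<and> n \<in> set ex"
proof (cases "k \<ge> 18")
  case False
  have "check_altsum \<sigma> e n ex (altsum \<sigma> e (Suc 17) n) (rev [1..int 17])"
    using assms altsum_18[of n "Suc 17" \<sigma> e] by (simp add: list_all_iff)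
  thus ?thesis by (rule check_altsum_imp) (use False assms in auto)
qed (use assms in \<open>simp add: altsum_18\<close>)

lemma altsum_1_4_9_nonneg: "0 \<le> n \<Longrightarrow> k > 0 \<Longrightarrow> altsum 14 osc_1_4_9 k n \<ge> 0 \<or> k = 1 \<and> (n = 9 \<or> n = 35)"
  using altsum_small[OF check_altsum_1_4_9, of n k] parts_1_4_9.altsum_nonneg_large[of k n] by (cases "n < 495") auto

lemma altsum_2_3_7_nonneg: "0 \<le> n \<Longrightarrow> k > 0 \<Longrightarrow> altsum 12 osc_2_3_7 k n \<ge> 0 \<or> k = 1 \<and> (n = 7 \<or> n = 13 \<or> n = 127)"
  using altsum_small[OF check_altsum_2_3_7, of n k] parts_2_3_7.altsum_nonneg_large[of k n] by (cases "n < 495") auto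

lemma int_pent_nat: "int (pent_nat k) = pent (int k)"
  by (simp add: pent_nat_def pent_def zdiv_int algebra_simps)

section \<open>Coefficients of the quotients by three factors\<close>

context quasi_quadratic begin

text \<open>Multiplying out gives a third-order difference of \<open>Q\<close>, which annihilates
  the quadratic part, while \<open>diff\<close> disposes of \<open>e\<close>. For
  \<open>n > 0\<close> all arguments exceed \<open>- \<sigma>\<close>, so the formula without
  cut-off applies; for \<open>n = 0\<close> only \<open>Q 0 = 2 * M\<close> remains.\<close>

lemma inverse_three_factors:
  fixes p q r :: nat
  assumes pos: "p > 0" "q > 0" "r > 0" and sum: "int p + int q + int r = \<sigma>"
    and diff: "\<And>n. e n - e (n - int p) - e (n - int q) - e (n - int r) + e (n - int (p + q)) +
                 e (n - int (p + r)) + e (n - int (q + r)) - e (n - int (p + q + r)) = 0"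
    and e0: "e 0 = 2 * M"
  shows "inverse ((1 - X ^ p) * (1 - X ^ q) * (1 - X ^ r)) =
           Abs_fps (\<lambda>n. of_int (Q (int n)) / of_int (2 * M))"
proof -
  define f where "f = Abs_fps (\<lambda>n. of_int (Q (int n)) / of_int (2 * M) :: rat)"
  have f: "fps_nth (X ^ a * f) n = of_int (Q (int n - int a)) / of_int (2 * M)" for a n
    by (auto simp: f_def fps_X_power_mult_nth quasi_val_def of_nat_diff)
  have key: "Q n - Q (n - int p) - Q (n - int q) - Q (n - int r) + Q (n - int (p + q)) +
                 Q (n - int (p + r)) + Q (n - int (q + r)) - Q (n - int (p + q + r)) =
                 (if n = 0 then 2 * M else 0)" if "n \<ge> 0" for n
  proof (cases "n = 0")
    case True
    thus ?thesis using pos e0 by (simp add: quasi_val_def)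
  next
    case False
    hence "Q (n - int a) = (n - int a) * (n - int a) + \<sigma> * (n - int a) + e (n - int a)" if "int a \<le> \<sigma>" for a
      using \<open>n \<ge> 0\<close> that by (intro quasi_val_eq) auto
    from this[of 0] this[of p] this[of q] this[of r] this[of "p + q"] this[of "p + r"] this[of "q + r"]
      this[of "p + q + r"] show ?thesis using sum diff[of n] False by (simp add: algebra_simps)
  qed
  have "(1 - X ^ p) * (1 - X ^ q) * (1 - X ^ r) * f =
     X ^ 0 * f - X ^ p * f - X ^ q * f - X ^ r * f + X ^ (p + q) * f + X ^ (p + r) * f + X ^ (q + r) * f
       - X ^ (p + q + r) * f"
    by (simp add: power_add algebra_simps)
  also have "\<dots> = 1"
  proof (rule fps_ext)
    fix n
    show "fps_nth (X ^ 0 * f - X ^ p * f - X ^ q * f - X ^ r * f + X ^ (p + q) * f + X ^ (p + r) * f + X ^ (q + r) * f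
       - X ^ (p + q + r) * f) n = fps_nth 1 n"
      unfolding fps_add_nth fps_sub_nth f using key[of "int n"] M
      unfolding diff_divide_distrib[symmetric] add_divide_distrib[symmetric] of_int_add[symmetric] of_int_diff[symmetric]
      by simp
  qed
  finally have "(1 - X ^ p) * (1 - X ^ q) * (1 - X ^ r) * f = 1" .
  thus ?thesis unfolding f_def by (rule fps_inverse_unique)
qed

text \<open>Downward induction in \<open>k\<close> along the common recurrence, starting from
  \<open>k > n\<close>, where both sides vanish.\<close>

lemma euler_qseries_nth:
  fixes f :: "rat fps"
  assumes f: "f = Abs_fps (\<lambda>n. of_int (Q (int n)) / of_int (2 * M))" and "k > 0"
  shows   "fps_nth (euler * qseries k * f) n = of_int (altsum \<sigma> e k (int n)) / of_int (2 * M)"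
  using \<open>k > 0\<close>
proof (induction "Suc n - k" arbitrary: k)
  case 0
  hence "n < k" by simp
  hence "fps_nth (euler * qseries k * f) n = 0"
    unfolding mult.commute[of euler] mult.assoc fps_mult_nth[of "qseries k"]
    by (intro sum.neutral) (auto simp: qseries_nth_0)
  moreover have "int n < pent (int k)" using pent_ge[of "int k"] \<open>n < k\<close> by simp
  ultimately show ?case by (simp add: altsum_eq_0)
next
  case (Suc d)
  have Xf: "fps_nth (X ^ a * f) n = of_int (Q (int n - int a)) / of_int (2 * M)" for a
    by (auto simp: f fps_X_power_mult_nth quasi_val_def of_nat_diff)
  have IH: "fps_nth (euler * qseries (Suc k) * f) n = of_int (altsum \<sigma> e (Suc k) (int n)) / of_int (2 * M)"
    by (rule Suc.hyps(1)) (use Suc.hyps(2) in auto)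
  have "euler * qseries k = pent_pair k - euler * qseries (Suc k)"
    using euler_qseries_add[of k] Suc.prems by (simp add: algebra_simps)
  hence "euler * qseries k * f = (pent_pair k - euler * qseries (Suc k)) * f"
    by (simp only:)
  also have "\<dots> = X ^ pent_nat k * f - X ^ (pent_nat k + (2 * k + 1)) * f - euler * qseries (Suc k) * f"
    unfolding power_add[of X "pent_nat k"] pent_pair_def by (simp only: algebra_simps mult_1_left mult_1_right)
  finally have "fps_nth (euler * qseries k * f) n =
     of_int (Q (int n - int (pent_nat k))) / of_int (2 * M) - of_int (Q (int n - int (pent_nat k + (2 * k + 1)))) / of_int (2 * M)
      - of_int (altsum \<sigma> e (Suc k) (int n)) / of_int (2 * M)"
    by (simp only: Xf fps_sub_nth IH)
  also have "\<dots> = of_int (altsum \<sigma> e k (int n)) / of_int (2 * M)"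
    unfolding altsum_rec[of \<sigma> e k] diff_divide_distrib[symmetric] of_int_diff[symmetric] pent_step_def
    by (simp add: int_pent_nat algebra_simps)
  finally show ?case .
qed

end

section \<open>Dividing by the remaining factors\<close>

lemma fps_nth_times_inverse_one_minus:
  assumes "p > 0"
  shows "fps_nth (f * inverse (1 - X ^ p)) n =
           fps_nth f n + (if n < p then 0 else fps_nth (f * inverse (1 - X ^ p)) (n - p))"
proof -
  have "inverse (1 - X ^ p) * (1 - X ^ p) = 1"
    by (rule inverse_mult_eq_1) (use assms in simp)
  hence "f = f * (inverse (1 - X ^ p) * (1 - X ^ p))" by simp
  also have "\<dots> = f * inverse (1 - X ^ p) - X ^ p * (f * inverse (1 - X ^ p))"
    by (simp only: algebra_simps mult_1_left mult_1_right)
  finally have "fps_nth f n = fps_nth (f * inverse (1 - X ^ p) - X ^ p * (f * inverse (1 - X ^ p))) n" by (rule arg_cong)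
  thus ?thesis by (simp add: fps_X_power_mult_nth)
qed

lemma quotient_nth_neg: "p > 0 \<Longrightarrow> n < 0 \<Longrightarrow> quotient_nth p f n = 0"
  by (simp add: quotient_nth_def div_neg_pos_less0)

lemma map_Suc_upto: "map (\<lambda>i. i + 1) [a..b] = [a + 1..b + 1 :: int]"
proof (induction a b rule: upto.induct)
  case (1 a b)
  thus ?case by (cases "a \<le> b") (simp_all add: upto_rec1[of a b] upto_rec1[of "a + 1" "b + 1"])
qed

lemma quotient_nth_rec:
  assumes "p > 0" "n \<ge> 0"
  shows   "quotient_nth p f n = f n + quotient_nth p f (n - p)"
proof -
  have d: "n div p \<ge> 0"
    using assms by (simp add: pos_imp_zdiv_nonneg_iff)
  have d': "(n - p) div p = n div p - 1"
    using assms div_add_self2[of p "n - p"] by simp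
  have "[0..n div p] = 0 # [1..n div p]"
    using d by (subst upto_rec1) auto
  also have "[1..n div p] = map (\<lambda>i. i + 1) [0..(n - p) div p]"
    unfolding d' map_Suc_upto by simp
  finally show ?thesis
    by (simp add: quotient_nth_def o_def algebra_simps)
qed

lemma nth_mult_inverse_one_minus:
  assumes "p > 0" "\<And>i. i \<le> n \<Longrightarrow> fps_nth f i = of_int (a (int i)) / c"
  shows   "fps_nth (f * inverse (1 - X ^ p)) n = of_int (quotient_nth (int p) a (int n)) / c"
  using assms(2)
proof (induction n rule: less_induct)
  case (less n)
  show ?case
  proof (cases "n < p")
    case True
    thus ?thesis using assms(1) less.prems[of n]
      by (subst fps_nth_times_inverse_one_minus) (auto simp: quotient_nth_rec quotient_nth_neg)
  next
    case False
    have "fps_nth (f * inverse (1 - X ^ p)) n = of_int (a (int n)) / c + of_int (quotient_nth (int p) a (int n - int p)) / c"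
      using assms(1) less.prems[of n] less.IH[of "n - p"] less.prems False
      by (subst fps_nth_times_inverse_one_minus) (auto simp: of_nat_diff)
    thus ?thesis using assms(1) by (simp add: quotient_nth_rec[of "int p" "int n"] add_divide_distrib)
  qed
qed

section \<open>Products of geometric series over sets of parts\<close>

lemma fps_nonneg_mult:
  fixes f g :: "rat fps"
  assumes "\<And>n. fps_nth f n \<ge> 0" "\<And>n. fps_nth g n \<ge> 0"
  shows   "fps_nth (f * g) n \<ge> 0"
  unfolding fps_mult_nth by (intro sum_nonneg mult_nonneg_nonneg assms)

lemma inverse_one_minus_nonneg:
  assumes "p > 0" shows "fps_nth (inverse (1 - X ^ p)) n \<ge> 0"
proof (induction n rule: less_induct)
  case (less n)
  show ?case
    using fps_nth_times_inverse_one_minus[of p 1 n] assms less.IH[of "n - p"] by (auto split: if_splits)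
qed

text \<open>Generating function of the partitions with parts in a finite set \<open>A\<close> of
  positive numbers; an infinite \<open>A\<close> gives the default value 1.\<close>

definition inv_parts :: "nat set \<Rightarrow> rat fps"
  where "inv_parts A = (\<Prod>p\<in>A. inverse (1 - X ^ p))"

lemma inv_parts_nonneg: "0 \<notin> A \<Longrightarrow> fps_nth (inv_parts A) n \<ge> 0"
proof (induction A arbitrary: n rule: infinite_finite_induct)
  case (insert p A)
  thus ?case unfolding inv_parts_def
    by (simp) (rule fps_nonneg_mult, auto intro!: inverse_one_minus_nonneg)
qed (auto simp: inv_parts_def)

lemma inv_parts_insert: "finite A \<Longrightarrow> p \<notin> A \<Longrightarrow> inv_parts (insert p A) = inverse (1 - X ^ p) * inv_parts A"
  by (simp add: inv_parts_def)

lemma inv_parts_Un: "finite A \<Longrightarrow> finite B \<Longrightarrow> A \<inter> B = {} \<Longrightarrow> inv_parts (A \<union> B) = inv_parts A * inv_parts B"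
  by (simp add: inv_parts_def prod.union_disjoint)

definition residue_parts :: "nat \<Rightarrow> nat \<Rightarrow> nat set" where "residue_parts a m = (\<lambda>j. 5 * j + a) ` {..<m}"

lemma finite_residue_parts [simp]: "finite (residue_parts a m)" by (simp add: residue_parts_def)

lemma qpoch_residue_parts: "qpoch (X ^ a) (X ^ 5) m = (\<Prod>p\<in>residue_parts a m. 1 - X ^ p)"
  unfolding qpoch_def residue_parts_def
  by (subst prod.reindex) (auto intro!: inj_onI prod.cong simp: power_mult[symmetric] power_add mult.commute)

text \<open>Parts larger than \<open>n\<close> do not affect coefficient \<open>n\<close>, so
  dividing \<open>euler\<close> by two infinite products amounts to multiplying by a finite
  \<open>inv_parts\<close>.\<close>

lemma nth_product_qseries:
  assumes split: "euler = B * qpochs_inf [X ^ a, X ^ b] (X ^ 5)" and ab: "a \<noteq> b" "a \<in> {1..4}" "b \<in> {1..4}" and "n < m"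
  shows   "fps_nth (B * S) n = fps_nth (euler * S * inv_parts (residue_parts a m \<union> residue_parts b m)) n"
proof -
  define A where "A = residue_parts a m \<union> residue_parts b m"
  have disj: "residue_parts a m \<inter> residue_parts b m = {}"
  proof (rule ccontr)
    assume "residue_parts a m \<inter> residue_parts b m \<noteq> {}"
    then obtain i j where "5 * i + a = 5 * j + b" by (auto simp: residue_parts_def)
    hence "(5 * i + a) mod 5 = (5 * j + b) mod 5" by simp
    thus False using ab by auto
  qed
  have 0: "0 \<notin> A" using ab by (auto simp: A_def residue_parts_def)
  have fin: "finite A" by (simp add: A_def)
  have "(\<Prod>p\<in>A. 1 - X ^ p) * inv_parts A = (\<Prod>p\<in>A. (1 - X ^ p) * inverse (1 - X ^ p))"
    by (simp add: inv_parts_def prod.distrib)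
  also have "\<dots> = 1"
    by (intro prod.neutral ballI inverse_mult_eq_1') (use 0 in \<open>auto intro: gr0I\<close>)
  finally have inv: "(\<Prod>p\<in>A. 1 - X ^ p) * inv_parts A = 1" .
  have "fps_eq_upto n (qpoch_inf (X ^ c) (X ^ 5)) (qpoch (X ^ c) (X ^ 5) m)" if "c > 0" for c
    by (rule qpoch_inf_eq_upto) (use that \<open>n < m\<close> in auto)
  hence "fps_eq_upto n (qpoch_inf (X ^ a) (X ^ 5) * qpoch_inf (X ^ b) (X ^ 5))
       (qpoch (X ^ a) (X ^ 5) m * qpoch (X ^ b) (X ^ 5) m)"
    using ab by (intro fps_eq_upto_mult) auto
  also have "qpoch (X ^ a) (X ^ 5) m * qpoch (X ^ b) (X ^ 5) m = (\<Prod>p\<in>A. 1 - X ^ p)"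
    unfolding qpoch_residue_parts A_def using disj by (simp add: prod.union_disjoint)
  finally have "fps_eq_upto n (qpochs_inf [X ^ a, X ^ b] (X ^ 5)) (\<Prod>p\<in>A. 1 - X ^ p)"
    by (simp add: qpochs_inf_def)
  hence "fps_eq_upto n ((B * S * inv_parts A) * qpochs_inf [X ^ a, X ^ b] (X ^ 5)) ((B * S * inv_parts A) * (\<Prod>p\<in>A. 1 - X ^ p))"
    by (intro fps_eq_upto_mult) auto
  also have "(B * S * inv_parts A) * (\<Prod>p\<in>A. 1 - X ^ p) = B * S * ((\<Prod>p\<in>A. 1 - X ^ p) * inv_parts A)"
    by (simp only: mult_ac)
  also have "(B * S * inv_parts A) * qpochs_inf [X ^ a, X ^ b] (X ^ 5) = euler * S * inv_parts A"
    unfolding split by (simp only: mult_ac)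
  finally show ?thesis unfolding inv A_def[symmetric] by (simp add: fps_eq_upto_def)
qed

lemma inv_parts_subset:
  assumes "finite A" "B \<subseteq> A" shows "inv_parts A = inv_parts B * inv_parts (A - B)"
proof -
  have "B \<union> (A - B) = A" using assms by blast
  thus ?thesis using inv_parts_Un[of B "A - B"] assms by (auto intro: finite_subset)
qed

text \<open>The eight-term difference of the table has period 36, so evaluating it on one period is
  enough.\<close>

lemma inverse_1_4_9:
  "inv_parts {1, 4, 9} = Abs_fps (\<lambda>n. of_int (quasi_val 14 osc_1_4_9 (int n)) / of_int (2 * 36))"
proof -
  have chk: "list_all (\<lambda>n. osc_1_4_9 n - osc_1_4_9 (n - 1) - osc_1_4_9 (n - 4) - osc_1_4_9 (n - 9) + osc_1_4_9 (n - 5) +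
                 osc_1_4_9 (n - 10) + osc_1_4_9 (n - 13) - osc_1_4_9 (n - 14) = 0) [0..35]"
    by code_simp
  have "inverse ((1 - X ^ 1) * (1 - X ^ 4) * (1 - X ^ 9)) = Abs_fps (\<lambda>n. of_int (quasi_val 14 osc_1_4_9 (int n)) / of_int (2 * 36))"
  proof (rule parts_1_4_9.inverse_three_factors)
    fix n :: int
    have "osc_1_4_9 (n mod 36 - c) = osc_1_4_9 (n - c)" for c by (intro parts_1_4_9.e_cong) (rule mod_diff_left_eq)
    moreover have "n mod 36 \<in> set [0..35]" by simp
    hence "osc_1_4_9 (n mod 36) - osc_1_4_9 (n mod 36 - 1) - osc_1_4_9 (n mod 36 - 4) - osc_1_4_9 (n mod 36 - 9) + osc_1_4_9 (n mod 36 - 5) +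
                 osc_1_4_9 (n mod 36 - 10) + osc_1_4_9 (n mod 36 - 13) - osc_1_4_9 (n mod 36 - 14) = 0"
      using chk unfolding list_all_iff by blast
    ultimately show "osc_1_4_9 n - osc_1_4_9 (n - int 1) - osc_1_4_9 (n - int 4) - osc_1_4_9 (n - int 9) + osc_1_4_9 (n - int (1 + 4)) +
                 osc_1_4_9 (n - int (1 + 9)) + osc_1_4_9 (n - int (4 + 9)) - osc_1_4_9 (n - int (1 + 4 + 9)) = 0"
      by (simp add: parts_1_4_9.periodic)
  next
    show "osc_1_4_9 0 = 2 * 36" by code_simp
  qed auto
  thus ?thesis by (simp add: inv_parts_def fps_inverse_mult mult_ac)
qed

lemma inverse_2_3_7:
  "inv_parts {2, 3, 7} = Abs_fps (\<lambda>n. of_int (quasi_val 12 osc_2_3_7 (int n)) / of_int (2 * 42))"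
proof -
  have chk: "list_all (\<lambda>n. osc_2_3_7 n - osc_2_3_7 (n - 2) - osc_2_3_7 (n - 3) - osc_2_3_7 (n - 7) + osc_2_3_7 (n - 5) +
                 osc_2_3_7 (n - 9) + osc_2_3_7 (n - 10) - osc_2_3_7 (n - 12) = 0) [0..41]"
    by code_simp
  have "inverse ((1 - X ^ 2) * (1 - X ^ 3) * (1 - X ^ 7)) = Abs_fps (\<lambda>n. of_int (quasi_val 12 osc_2_3_7 (int n)) / of_int (2 * 42))"
  proof (rule parts_2_3_7.inverse_three_factors)
    fix n :: int
    have "osc_2_3_7 (n mod 42 - c) = osc_2_3_7 (n - c)" for c by (intro parts_2_3_7.e_cong) (rule mod_diff_left_eq)
    moreover have "n mod 42 \<in> set [0..41]" by simp
    hence "osc_2_3_7 (n mod 42) - osc_2_3_7 (n mod 42 - 2) - osc_2_3_7 (n mod 42 - 3) - osc_2_3_7 (n mod 42 - 7) + osc_2_3_7 (n mod 42 - 5) +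
                 osc_2_3_7 (n mod 42 - 9) + osc_2_3_7 (n mod 42 - 10) - osc_2_3_7 (n mod 42 - 12) = 0"
      using chk unfolding list_all_iff by blast
    ultimately show "osc_2_3_7 n - osc_2_3_7 (n - int 2) - osc_2_3_7 (n - int 3) - osc_2_3_7 (n - int 7) + osc_2_3_7 (n - int (2 + 3)) +
                 osc_2_3_7 (n - int (2 + 7)) + osc_2_3_7 (n - int (3 + 7)) - osc_2_3_7 (n - int (2 + 3 + 7)) = 0"
      by (simp add: parts_2_3_7.periodic)
  next
    show "osc_2_3_7 0 = 2 * 42" by code_simp
  qed auto
  thus ?thesis by (simp add: inv_parts_def fps_inverse_mult mult_ac)
qed

lemmas nth_1_4_9 = parts_1_4_9.euler_qseries_nth[OF inverse_1_4_9]
lemmas nth_2_3_7 = parts_2_3_7.euler_qseries_nth[OF inverse_2_3_7]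

section \<open>Non-negativity of the first series\<close>

lemma euler_qseries_1_4_6_9_nonneg:
  assumes "k > 0"
  shows   "fps_nth (euler * qseries k * inv_parts {1, 4, 9} * inverse (1 - X ^ 6)) n \<ge> 0"
proof (induction n rule: less_induct)
  case (less n)
  define P where "P = euler * qseries k * inv_parts {1, 4, 9}"
  have P: "fps_nth P n = of_int (altsum 14 osc_1_4_9 k (int n)) / 72" for n
    unfolding P_def using nth_1_4_9[OF assms] by simp
  note rec = fps_nth_times_inverse_one_minus[of 6 P]
  have IH: "i < n \<Longrightarrow> 0 \<le> fps_nth (P * inverse (1 - X ^ 6)) i" for i
    using less.IH[of i] by (simp add: P_def)
  have nn: "fps_nth P i \<ge> 0" if "\<not> (k = 1 \<and> (i = 9 \<or> i = 35))" for i
    using altsum_1_4_9_nonneg[of "int i" k] that assms by (auto simp: P)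
  have "0 \<le> fps_nth (P * inverse (1 - X ^ 6)) n"
  proof (cases "k = 1 \<and> (n = 9 \<or> n = 35)")
    case False
    thus ?thesis using rec[of n] nn[of n] IH[of "n - 6"] by (auto split: if_splits)
  next
    case True
    \<comment> \<open>At the exceptional indices the recurrence is unfolded twice; what remains
      beyond these two coefficients is covered by the induction hypothesis.\<close>
    have "fps_nth P n + fps_nth P (n - 6) \<ge> 0"
      using True check_1_4_6_9 unfolding P by (auto simp: altsum_1_eq_code[unfolded One_nat_def] add_divide_distrib[symmetric] of_int_add[symmetric] simp del: of_int_add)
    moreover have "n \<ge> 12 \<Longrightarrow> fps_nth (P * inverse (1 - X ^ 6)) (n - 6 - 6) \<ge> 0"
      by (rule IH) auto
    ultimately show ?thesis using True rec[of n] rec[of "n - 6"] by (auto split: if_splits)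
  qed
  thus ?case by (simp add: P_def)
qed

lemma series_2_3_5_nonneg:
  assumes "k > 0"
  shows   "fps_nth (qpochs_inf [X ^ 2, X ^ 3, X ^ 5] (X ^ 5) * qseries k) n \<ge> 0"
proof -
  \<comment> \<open>With \<open>n + 2\<close> the index \<open>j = 1\<close>, which yields 6 and 9,
    is present for every \<open>n\<close>.\<close>
  define A where "A = residue_parts 1 (n + 2) \<union> residue_parts 4 (n + 2)"
  have A: "{1, 4, 9, 6} \<subseteq> A" "0 \<notin> A" "finite A"
    by (auto simp: A_def residue_parts_def image_iff intro: bexI[of _ 0] bexI[of _ 1])
  have "fps_nth (qpochs_inf [X ^ 2, X ^ 3, X ^ 5] (X ^ 5) * qseries k) n = fps_nth (euler * qseries k * inv_parts A) n"
    unfolding A_def by (rule nth_product_qseries) (use euler_split in auto)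
  also have "inv_parts A = inv_parts {1, 4, 9, 6} * inv_parts (A - {1, 4, 9, 6})"
    using A by (intro inv_parts_subset) auto
  also have "inv_parts {1, 4, 9, 6} = inv_parts {1, 4, 9} * inverse (1 - X ^ 6)"
    by (simp add: inv_parts_def mult_ac)
  also have "fps_nth (euler * qseries k * (inv_parts {1, 4, 9} * inverse (1 - X ^ 6) * inv_parts (A - {1, 4, 9, 6}))) n =
     fps_nth ((euler * qseries k * inv_parts {1, 4, 9} * inverse (1 - X ^ 6)) * inv_parts (A - {1, 4, 9, 6})) n"
    by (simp only: mult.assoc)
  also have "\<dots> \<ge> 0"
    by (intro fps_nonneg_mult euler_qseries_1_4_6_9_nonneg inv_parts_nonneg assms) (use A in auto)
  finally show ?thesis .
qed

section \<open>Signs of the coefficients of the second series\<close>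

lemma series_1_4_5_nth:
  assumes "{2, 3, 7, 8, 13} \<subseteq> A" "A = residue_parts 2 (n + 3) \<union> residue_parts 3 (n + 3)"
  shows "fps_nth (qpochs_inf [X, X ^ 4, X ^ 5] (X ^ 5) * qseries k) n =
    fps_nth (euler * qseries k * inv_parts {2, 3, 7} * inverse (1 - X ^ 8) * inverse (1 - X ^ 13) * inv_parts (A - {2, 3, 7, 8, 13})) n"
proof -
  have "fps_nth (qpochs_inf [X, X ^ 4, X ^ 5] (X ^ 5) * qseries k) n = fps_nth (euler * qseries k * inv_parts A) n"
    unfolding assms(2) by (rule nth_product_qseries) (use euler_split' in auto)
  also have "inv_parts A = inv_parts {2, 3, 7, 8, 13} * inv_parts (A - {2, 3, 7, 8, 13})"
    using assms by (intro inv_parts_subset) auto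
  also have "inv_parts {2, 3, 7, 8, 13} = inv_parts {2, 3, 7} * inverse (1 - X ^ 8) * inverse (1 - X ^ 13)"
    by (simp add: inv_parts_def mult_ac)
  finally show ?thesis by (simp only: mult.assoc)
qed

text \<open>The bound \<open>n + 3\<close> admits \<open>j = 2\<close>, which yields 13. The gap
  between 12 and 17 limits where the negative coefficients can act later.\<close>

lemma parts_2_3:
  assumes "A = residue_parts 2 (n + 3) \<union> residue_parts 3 (n + 3)"
  shows   "{2, 3, 7, 8, 13} \<subseteq> A" "finite A" "\<And>p. p \<in> A - {2, 3, 7, 8, 13} \<Longrightarrow> p = 12 \<or> p \<ge> 17"
proof -
  show "{2, 3, 7, 8, 13} \<subseteq> A"
    unfolding assms by (auto simp: residue_parts_def image_iff intro: bexI[of _ 0] bexI[of _ 1] bexI[of _ 2])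
  show "finite A" by (simp add: assms)
  fix p assume p: "p \<in> A - {2, 3, 7, 8, 13}"
  then obtain j where "p = 5 * j + 2 \<or> p = 5 * j + 3" by (auto simp: assms residue_parts_def)
  moreover have "j = 0 \<or> j = 1 \<or> j = 2 \<or> j \<ge> 3" by linarith
  ultimately show "p = 12 \<or> p \<ge> 17" using p by auto
qed

lemma series_1_4_5_nonneg:
  assumes "k > 1"
  shows   "fps_nth (qpochs_inf [X, X ^ 4, X ^ 5] (X ^ 5) * qseries k) n \<ge> 0"
proof -
  define A where "A = residue_parts 2 (n + 3) \<union> residue_parts 3 (n + 3)"
  note A = parts_2_3[OF A_def]
  have "0 \<notin> A - {2, 3, 7, 8, 13}" using A(3)[of 0] by auto
  moreover define P where "P = euler * qseries k * inv_parts {2, 3, 7}"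
  moreover have "fps_nth P n \<ge> 0" for n
    unfolding P_def using nth_2_3_7[of k n] altsum_2_3_7_nonneg[of "int n" k] assms by simp
  ultimately show ?thesis
    unfolding series_1_4_5_nth[OF A(1) A_def] P_def[symmetric]
    by (intro fps_nonneg_mult inverse_one_minus_nonneg inv_parts_nonneg) auto
qed

text \<open>The coefficients \<open>-1\<close> at 7 and 13 lower the coefficients at \<open>p + 7\<close> and \<open>p + 13\<close>, for each part \<open>p\<close>,
  by at most 1 and have no further effect, because the coefficients there remain non-negative.\<close>

lemma nth_mult_large_parts:
  fixes W :: "rat fps"
  assumes "finite T" "\<And>p. p \<in> T \<Longrightarrow> p = 12 \<or> p \<ge> 17"
    and W: "fps_nth W 1 = 0" "fps_nth W 7 = -1" "fps_nth W 13 = -1" "\<And>n. n \<noteq> 7 \<Longrightarrow> n \<noteq> 13 \<Longrightarrow> fps_nth W n \<ge> 0"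
      "fps_nth W 19 \<ge> 1" "\<And>n. n \<ge> 22 \<Longrightarrow> fps_nth W n \<ge> 2"
  defines "g \<equiv> \<lambda>T. W * inv_parts T"
  shows "fps_nth (g T) 1 = 0 \<and> fps_nth (g T) 7 = -1 \<and> fps_nth (g T) 13 = -1 \<and>
    (\<forall>n. n \<noteq> 7 \<longrightarrow> n \<noteq> 13 \<longrightarrow> fps_nth (g T) n \<ge> 0) \<and>
    (\<forall>n\<ge>14. fps_nth (g T) n \<ge> fps_nth W n - of_bool (n - 7 \<in> T) - of_bool (n - 13 \<in> T))"
  using assms(1,2)
proof (induction T rule: finite_induct)
  case empty
  thus ?case using W by (simp add: g_def inv_parts_def)
next
  case (insert p T)
  have p: "p = 12 \<or> p \<ge> 17" using insert.prems by blast
  have "g (insert p T) = g T * inverse (1 - X ^ p)"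
    using insert.hyps by (simp add: g_def inv_parts_insert mult_ac)
  hence rec: "fps_nth (g (insert p T)) n = fps_nth (g T) n + (if n < p then 0 else fps_nth (g (insert p T)) (n - p))" for n
    using fps_nth_times_inverse_one_minus[of p "g T" n] p by auto
  have IH: "fps_nth (g T) 1 = 0" "fps_nth (g T) 7 = -1" "fps_nth (g T) 13 = -1"
    "\<And>n. n \<noteq> 7 \<Longrightarrow> n \<noteq> 13 \<Longrightarrow> fps_nth (g T) n \<ge> 0"
    "\<And>n. n \<ge> 14 \<Longrightarrow> fps_nth (g T) n \<ge> fps_nth W n - of_bool (n - 7 \<in> T) - of_bool (n - 13 \<in> T)"
    using insert.IH insert.prems by blast+
  have 1: "fps_nth (g (insert p T)) 1 = 0" "fps_nth (g (insert p T)) 7 = -1"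
    using rec[of 1] rec[of 7] IH p by auto
  \<comment> \<open>For \<open>p = 12\<close> the recurrence reaches 13 - 12 = 1, which is why the
    coefficient at 1 is tracked.\<close>
  have 13: "fps_nth (g (insert p T)) 13 = -1"
    using rec[of 13] IH(3) p 1 by auto
  have main: "(n \<noteq> 7 \<longrightarrow> n \<noteq> 13 \<longrightarrow> fps_nth (g (insert p T)) n \<ge> 0) \<and>
    (n \<ge> 14 \<longrightarrow> fps_nth (g (insert p T)) n \<ge> fps_nth W n - of_bool (n - 7 \<in> insert p T) - of_bool (n - 13 \<in> insert p T))" for n
  proof (induction n rule: less_induct)
    case (less n)
    \<comment> \<open>By induction, only the coefficients at 7 and 13 of the new series can be
      negative, and both are -1.\<close>
    have prev: "(if n < p then 0 else fps_nth (g (insert p T)) (n - p)) \<ge> - of_bool (n = p + 7) - of_bool (n = p + 13)"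
      using less.IH[of "n - p"] p 1 13 by (auto simp: not_less le_iff_add)
    show ?case
    proof (cases "n \<ge> 14")
      case False
      hence "n \<noteq> 7 \<longrightarrow> n \<noteq> 13 \<longrightarrow> fps_nth (g (insert p T)) n \<ge> 0"
        using rec[of n] IH(4)[of n] prev p by (auto split: if_splits)
      thus ?thesis using False by simp
    next
      case True
      have "of_bool (n - 7 \<in> insert p T) = of_bool (n - 7 \<in> T) + (of_bool (n = p + 7) :: rat)"
        "of_bool (n - 13 \<in> insert p T) = of_bool (n - 13 \<in> T) + (of_bool (n = p + 13) :: rat)"
        using True insert.hyps by auto
      hence lower: "fps_nth (g (insert p T)) n \<ge> fps_nth W n - of_bool (n - 7 \<in> insert p T) - of_bool (n - 13 \<in> insert p T)"
        using rec[of n] IH(5)[OF True] prev by linarith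
      moreover have "fps_nth W n - of_bool (n - 7 \<in> insert p T) - of_bool (n - 13 \<in> insert p T) \<ge> 0"
      proof (cases "n \<ge> 22")
        case True
        thus ?thesis using W(6)[OF True] by (auto simp: of_bool_def)
      next
        case False
        \<comment> \<open>Below 22 a deduction is possible only at 19 = 12 + 7; the next ones are at
          24 = 17 + 7 and 25 = 12 + 13, where \<open>W\<close> is at least 2.\<close>
        have "n - 13 \<notin> insert p T" "n - 7 \<in> insert p T \<Longrightarrow> n = 19"
          using insert.prems[of "n - 13"] insert.prems[of "n - 7"] False by linarith+
        thus ?thesis using W(5) W(4)[of n] True by (cases "n - 7 \<in> insert p T") auto
      qed
      ultimately show ?thesis by linarith
    qed
  qed
  show ?case using 1 13 main by blast
qed

text \<open>Evaluation settles the indices up to 34. The 13 consecutive values from 22 to 34 are at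
  least 2, and this propagates in steps of 13 because the quotient \<open>V\<close> before division
  by 1 - q^13 is non-negative from 14 on.\<close>

lemma euler_qseries_1_2_3_7_8_13:
  defines "W \<equiv> euler * qseries 1 * inv_parts {2, 3, 7} * inverse (1 - X ^ 8) * inverse (1 - X ^ 13)"
  shows "fps_nth W 1 = 0" "fps_nth W 7 = -1" "fps_nth W 13 = -1" "\<And>n. n \<noteq> 7 \<Longrightarrow> n \<noteq> 13 \<Longrightarrow> fps_nth W n \<ge> 0"
      "fps_nth W 19 \<ge> 1" "\<And>n. n \<ge> 22 \<Longrightarrow> fps_nth W n \<ge> 2"
proof -
  define P where "P = euler * qseries 1 * inv_parts {2, 3, 7}"
  define V where "V = P * inverse (1 - X ^ 8)"
  define v where "v = quotient_nth 8 (altsum_1_code 12 osc_2_3_7)"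
  define w where "w = quotient_nth 13 v"
  have P: "fps_nth P n = of_int (altsum 12 osc_2_3_7 1 (int n)) / 84" for n
    unfolding P_def using nth_2_3_7[of 1] by simp
  have P': "fps_nth P n = of_int (altsum_1_code 12 osc_2_3_7 (int n)) / 84" if "n < 495" for n
    unfolding P using that by (subst altsum_1_eq_code) auto
  have V: "fps_nth V n = of_int (v (int n)) / 84" if "n < 495" for n
    unfolding V_def v_def using that nth_mult_inverse_one_minus[of 8 n P "altsum_1_code 12 osc_2_3_7" 84] P' by simp
  have W: "fps_nth W n = of_int (w (int n)) / 84" if "n < 495" for n
    unfolding W_def P_def[symmetric] V_def[symmetric] w_def using that nth_mult_inverse_one_minus[of 13 n V v 84] V by simp
  have chk: "w n \<ge> (if n = 19 then 84 else if n < 22 then 0 else 168)" if "0 \<le> n" "n \<le> 34" "n \<noteq> 7" "n \<noteq> 13" for n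
  proof -
    have "\<forall>n\<in>set [0..34]. w n \<ge> (if n = 19 then 84 else if n < 22 then 0 else 168) \<or> n = 7 \<or> n = 13"
      using check_2_3_7_8_13 unfolding w_def v_def list_all_iff by blast
    moreover have "n \<in> set [0..34]" unfolding set_upto using that by simp
    ultimately show ?thesis using that(3,4) by blast
  qed
  show "fps_nth W 1 = 0" "fps_nth W 7 = -1" "fps_nth W 13 = -1"
    using check_2_3_7_8_13 by (simp_all add: W w_def v_def)
  show "fps_nth W 19 \<ge> 1" using chk[of 19] by (simp add: W)
  have Pn: "fps_nth P n \<ge> 0" if "n \<noteq> 7" "n \<noteq> 13" "n \<noteq> 127" for n
    using altsum_2_3_7_nonneg[of "int n" 1] that by (auto simp: P)
  have V14: "fps_nth V n \<ge> 0" if "n \<ge> 14" for n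
    using that
  proof (induction n rule: less_induct)
    case (less n)
    note rec = fps_nth_times_inverse_one_minus[of 8 P, folded V_def]
    consider "n \<le> 21" | "n = 127" | "n \<ge> 22" "n \<noteq> 127" by linarith
    thus ?case
    proof cases
      case 1
      have "\<forall>i\<in>set [14..21]. v i \<ge> 0"
        using check_2_3_7_8 unfolding v_def list_all_iff by blast
      moreover have "int n \<in> set [14..21]" unfolding set_upto using 1 less.prems by simp
      ultimately have "v (int n) \<ge> 0" by blast
      thus ?thesis using 1 V[of n] by simp
    next
      case 2
      \<comment> \<open>Two unfoldings give coefficient 127 of \<open>V\<close> as the coefficients
        127 and 119 of \<open>P\<close> plus coefficient 111 of \<open>V\<close>.\<close>
      have "fps_nth P 119 + fps_nth P 127 \<ge> 0"
        using check_2_3_7_8 unfolding P by (simp add: altsum_1_eq_code[unfolded One_nat_def] add_divide_distrib[symmetric] of_int_add[symmetric] del: of_int_add)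
      moreover have "fps_nth V 111 \<ge> 0" using less.IH[of 111] 2 by simp
      ultimately show ?thesis using rec[of 127] rec[of 119] 2 by simp
    next
      case 3
      thus ?thesis using rec[of n] Pn[of n] less.IH[of "n - 8"] by simp
    qed
  qed
  show W22: "fps_nth W n \<ge> 2" if "n \<ge> 22" for n
    using that
  proof (induction n rule: less_induct)
    case (less n)
    show ?case
    proof (cases "n \<le> 34")
      case True
      thus ?thesis using chk[of "int n"] less.prems by (simp add: W)
    next
      case False
      have "W = V * inverse (1 - X ^ 13)" by (simp add: W_def V_def P_def)
      hence "fps_nth W n = fps_nth V n + fps_nth W (n - 13)"
        using fps_nth_times_inverse_one_minus[of 13 V n] False by simp
      moreover have "fps_nth V n \<ge> 0" by (rule V14) (use False in simp)
      moreover have "fps_nth W (n - 13) \<ge> 2" by (rule less.IH) (use False in auto)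
      ultimately show ?thesis by linarith
    qed
  qed
  show "fps_nth W n \<ge> 0" if "n \<noteq> 7" "n \<noteq> 13" for n
  proof (cases "n \<ge> 22")
    case False
    thus ?thesis using chk[of "int n"] that by (simp add: W split: if_splits)
  qed (use W22[of n] in auto)
qed

lemma series_1_4_5_k_1:
  "n = 7 \<or> n = 13 \<Longrightarrow> fps_nth (qpochs_inf [X, X ^ 4, X ^ 5] (X ^ 5) * qseries 1) n = -1"
  "n \<noteq> 7 \<Longrightarrow> n \<noteq> 13 \<Longrightarrow> fps_nth (qpochs_inf [X, X ^ 4, X ^ 5] (X ^ 5) * qseries 1) n \<ge> 0"
proof -
  define A where "A = residue_parts 2 (n + 3) \<union> residue_parts 3 (n + 3)"
  define W where "W = euler * qseries 1 * inv_parts {2, 3, 7} * inverse (1 - X ^ 8) * inverse (1 - X ^ 13)"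
  note parts = parts_2_3[OF A_def]
  have eq: "fps_nth (qpochs_inf [X, X ^ 4, X ^ 5] (X ^ 5) * qseries 1) n =
      fps_nth (W * inv_parts (A - {2, 3, 7, 8, 13})) n"
    unfolding W_def by (rule series_1_4_5_nth[OF parts(1) A_def])
  note * = nth_mult_large_parts[OF finite_Diff[OF parts(2)] parts(3) euler_qseries_1_2_3_7_8_13, folded W_def]
  show "fps_nth (qpochs_inf [X, X ^ 4, X ^ 5] (X ^ 5) * qseries 1) n = -1" if "n = 7 \<or> n = 13"
    unfolding eq using * that by metis
  show "fps_nth (qpochs_inf [X, X ^ 4, X ^ 5] (X ^ 5) * qseries 1) n \<ge> 0" if "n \<noteq> 7" "n \<noteq> 13"
    unfolding eq using * that by metis
qed

theorem corollary2p2: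
  shows "(\<forall>k>0. \<forall>m. fps_nth
             (qpochs_inf [fps_X ^ 2, fps_X ^ 3, fps_X ^ 5] (fps_X ^ 5) * qseries k) m \<ge> 0) \<and>
         (\<forall>k>1. \<forall>m. fps_nth
             (qpochs_inf [fps_X, fps_X ^ 4, fps_X ^ 5] (fps_X ^ 5) * qseries k) m \<ge> 0) \<and>
         fps_nth (qpochs_inf [fps_X, fps_X ^ 4, fps_X ^ 5] (fps_X ^ 5) * qseries 1) 7 = -1 \<and>
         fps_nth (qpochs_inf [fps_X, fps_X ^ 4, fps_X ^ 5] (fps_X ^ 5) * qseries 1) 13 = -1 \<and>
         (\<forall>m. m \<noteq> 7 \<and> m \<noteq> 13 \<longrightarrow> fps_nth
             (qpochs_inf [fps_X, fps_X ^ 4, fps_X ^ 5] (fps_X ^ 5) * qseries 1) m \<ge> 0)"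
  by (intro conjI allI impI series_2_3_5_nonneg series_1_4_5_nonneg series_1_4_5_k_1) simp_all

end
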